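(* Let $\mathfrak{g}$ be a compact real Lie algebra with Cartan subalgebra $\mathfrak{t}$, root system $\Delta$, a set of positive roots $\Delta_+$ and the set of simple roots $\Pi\subset\Delta_+$. For every non-simple positive root $\alpha\in\Delta_+\setminus\Pi$, fix a decomposition $\alpha=\zeta_\alpha+\eta_\alpha$ with $\zeta_\alpha,\eta_\alpha\in\Delta_+$. Then there exists a Chevalley basis $(X_\alpha)_{\alpha\in\Delta}$ of $\mathfrak{g}^{\mathbb{C}}$, with corresponding Chevalley constants $(c_{\alpha,\beta})$, with the following properties: \begin{itemize} \item[(i)] For every $\alpha\in\Delta_+$ we have $X_{-\alpha}=-\overline{X_\alpha}$. \item[(ii)] For every $\alpha\in\Delta_+\setminus\Pi$ we have $c_{\zeta_\alpha,\eta_\alpha}>0$. \end{itemize} Any two such Chevalley bases have the same Chevalley constants $(c_{\alpha,\beta})$.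
   Context: A compact real Lie algebra here means a real Lie algebra with negative definite Killing form $\kappa$. $\mathfrak{g}^{\mathbb{C}}$ is the complexification, $\kappa$ also denotes its Killing form, and $X\mapsto\overline{X}$ is the conjugation of $\mathfrak{g}^{\mathbb{C}}$ with respect to $\mathfrak{g}$. $\Delta\subset(\mathfrak{t}^{\mathbb{C}})^*$ is the root system of $\mathfrak{g}^{\mathbb{C}}$ with respect to $\mathfrak{t}^{\mathbb{C}}$, with root spaces $\mathfrak{g}^{\mathbb{C}}_\alpha=\{X\in\mathfrak{g}^{\mathbb{C}}:\mathrm{ad}(H)X=\alpha(H)X\ \forall H\in\mathfrak{t}\}$. For $\alpha\in\Delta$, $\alpha^\sharp\in i\mathfrak{t}$ is the vector with $\kappa(\alpha^\sharp,H)=\alpha(H)$ for all $H\in\mathfrak{t}$. Positive roots are taken with respect to some $H_0\in\mathfrak{t}$ on which no root vanishes: $\Delta_+=\{\alpha\in\Delta:\alpha(H_0)\in i\mathbb{R}_+\}$. A positive root is simple if it is not the sum of two positive roots. A family $(X_\alpha)_{\alpha\in\Delta}$ is a Chevalley basis of $\mathfrak{g}^{\mathbb{C}}$ if $X_\alpha\in\mathfrak{g}^{\mathbb{C}}_\alpha$ for every $\alpha\in\Delta$ and there exist real numbers $c_{\alpha,\beta}$ (the corresponding Chevalley constants) such that for all $\alpha,\beta\in\Delta$: $[X_\alpha,X_\beta]=c_{\alpha,\beta}X_{\alpha+\beta}$ if $\alpha+\beta\in\Delta$; $[X_\alpha,X_\beta]=\alpha^\sharp$ if $\alpha+\beta=0$;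 $[X_\alpha,X_\beta]=0$ otherwise; and $c_{-\alpha,-\beta}=-c_{\alpha,\beta}$. One puts $c_{\alpha,\beta}:=0$ whenever $\alpha+\beta\notin\Delta$ and $\beta\neq-\alpha$; $c_{\alpha,-\alpha}$ is not considered. *)

theory Defs
  imports Complex_Main "HOL-Library.Product_Plus" "HOL-Library.Function_Algebras"
begin

text \<open>The trace of an endomorphism, computed in the basis \<open>extend_basis {}\<close>; in finite dimension
  the value does not depend on this choice.\<close>

definition (in vector_space) endo_trace :: "('b \<Rightarrow> 'b) \<Rightarrow> 'a" where
  "endo_trace f = (\<Sum>b\<in>extend_basis {}. representation (extend_basis {}) (f b) b)"

locale lie_algebra = vector_space scale
  for scale :: "'f::field \<Rightarrow> 'v::ab_group_add \<Rightarrow> 'v" +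
  fixes br :: "'v \<Rightarrow> 'v \<Rightarrow> 'v"
  assumes finite_dim: "\<exists>B. finite B \<and> span B = UNIV"
    and linear_br_left: "Vector_Spaces.linear scale scale (\<lambda>x. br x y)"
    and linear_br_right: "Vector_Spaces.linear scale scale (\<lambda>y. br x y)"
    and br_self: "br x x = 0"
    and jacobi: "br x (br y z) + br y (br z x) + br z (br x y) = 0"

definition killing :: "('f::field \<Rightarrow> 'v::ab_group_add \<Rightarrow> 'v) \<Rightarrow> ('v \<Rightarrow> 'v \<Rightarrow> 'v) \<Rightarrow> 'v \<Rightarrow> 'v \<Rightarrow> 'f" where
  "killing scale br x y = vector_space.endo_trace scale (\<lambda>z. br x (br y z))"

definition compact_lie_algebra :: "('a::real_vector \<Rightarrow> 'a \<Rightarrow> 'a) \<Rightarrow> bool" where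
  "compact_lie_algebra br \<longleftrightarrow>
     lie_algebra scaleR br \<and> (\<forall>x. x \<noteq> 0 \<longrightarrow> killing scaleR br x x < 0)"


subsection \<open>Cartan subalgebras\<close>

definition subalgebra :: "('a::real_vector \<Rightarrow> 'a \<Rightarrow> 'a) \<Rightarrow> 'a set \<Rightarrow> bool" where
  "subalgebra br S \<longleftrightarrow> subspace S \<and> (\<forall>x\<in>S. \<forall>y\<in>S. br x y \<in> S)"

primrec lower_central :: "('a::real_vector \<Rightarrow> 'a \<Rightarrow> 'a) \<Rightarrow> 'a set \<Rightarrow> nat \<Rightarrow> 'a set" where
  "lower_central br S 0 = S"
| "lower_central br S (Suc n) = span {br x y | x y. x \<in> S \<and> y \<in> lower_central br S n}"

definition nilpotent :: "('a::real_vector \<Rightarrow> 'a \<Rightarrow> 'a) \<Rightarrow> 'a set \<Rightarrow> bool" where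
  "nilpotent br S \<longleftrightarrow> (\<exists>n. lower_central br S n = {0})"

definition normalizer :: "('a::real_vector \<Rightarrow> 'a \<Rightarrow> 'a) \<Rightarrow> 'a set \<Rightarrow> 'a set" where
  "normalizer br S = {x. \<forall>y\<in>S. br x y \<in> S}"

definition cartan_subalgebra :: "('a::real_vector \<Rightarrow> 'a \<Rightarrow> 'a) \<Rightarrow> 'a set \<Rightarrow> bool" where
  "cartan_subalgebra br t \<longleftrightarrow> subalgebra br t \<and> nilpotent br t \<and> normalizer br t = t"


subsection \<open>Complexification\<close>

text \<open>The pair \<open>(x, y)\<close> stands for \<open>x + i y\<close>.\<close>

type_synonym 'a complexification = "'a \<times> 'a"

definition of_real_form :: "'a::real_vector \<Rightarrow> 'a complexification" where
  "of_real_form x = (x, 0)"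

definition cscale :: "complex \<Rightarrow> 'a::real_vector complexification \<Rightarrow> 'a complexification" where
  "cscale z u = (Re z *\<^sub>R fst u - Im z *\<^sub>R snd u, Re z *\<^sub>R snd u + Im z *\<^sub>R fst u)"

definition cbr :: "('a::real_vector \<Rightarrow> 'a \<Rightarrow> 'a)
    \<Rightarrow> 'a complexification \<Rightarrow> 'a complexification \<Rightarrow> 'a complexification" where
  "cbr br u v = (br (fst u) (fst v) - br (snd u) (snd v), br (fst u) (snd v) + br (snd u) (fst v))"

definition conjugation :: "'a::real_vector complexification \<Rightarrow> 'a complexification" where
  "conjugation u = (fst u, - snd u)"

lemma lie_algebra_complexification:
  assumes "lie_algebra scaleR br"
  shows "lie_algebra cscale (cbr br)"
proof -
  interpret L: lie_algebra scaleR br by (fact assms)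
  interpret V: vector_space "cscale :: complex \<Rightarrow> 'a complexification \<Rightarrow> _"
    by unfold_locales
      (simp_all add: cscale_def scaleR_add_left scaleR_add_right scaleR_diff_left
        scaleR_diff_right)
  interpret l: Vector_Spaces.linear scaleR scaleR "\<lambda>x. br x y" for y
    by (rule L.linear_br_left)
  interpret r: Vector_Spaces.linear scaleR scaleR "\<lambda>y. br x y" for x
    by (rule L.linear_br_right)
  note bil = l.add r.add l.scale r.scale l.neg r.neg l.diff r.diff
  have anti: "br x y + br y x = 0" for x y
  proof -
    have "br (x + y) (x + y) = br x x + br x y + (br y x + br y y)"
      by (simp only: l.add r.add add.assoc add.left_commute)
    then show ?thesis by (simp add: L.br_self)
  qed
  show ?thesis
  proof unfold_locales
    obtain B where B: "finite B" "span B = (UNIV :: 'a set)"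
      using L.finite_dim unfolding span_raw_def by blast
    let ?C = "of_real_form ` B"
    have emb: "of_real_form x \<in> V.span ?C" for x
    proof -
      have "x \<in> span B" using B by simp
      then show ?thesis
      proof (induction rule: span_induct_alt)
        case base
        then show ?case using V.span_zero[of ?C] by (simp add: of_real_form_def zero_prod_def)
      next
        case (step c x y)
        have "of_real_form (c *\<^sub>R x + y) = cscale (of_real c) (of_real_form x) + of_real_form y"
          by (simp add: of_real_form_def cscale_def)
        then show ?case using step by (auto intro: V.span_add V.span_scale V.span_base)
      qed
    qed
    have "u \<in> V.span ?C" for u
    proof -
      have "u = of_real_form (fst u) + cscale \<i> (of_real_form (snd u))"
        by (simp add: of_real_form_def cscale_def)
      then show ?thesis using emb by (metis V.span_add V.span_scale)
    qed
    then show "\<exists>B. finite B \<and> V.span B = (UNIV :: 'a complexification set)"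
      using B by (intro exI[of _ ?C]) auto
  next
    fix x y z :: "'a complexification"
    show "cbr br x x = 0"
      using anti[of "fst x" "snd x"] by (simp add: cbr_def L.br_self zero_prod_def)
    define J where "J a b c = br a (br b c) + br b (br c a) + br c (br a b)" for a b c
    have J0: "J a b c = 0" for a b c by (simp add: J_def L.jacobi)
    obtain x1 x2 y1 y2 z1 z2 where [simp]: "x = (x1, x2)" "y = (y1, y2)" "z = (z1, z2)"
      by (metis surj_pair)
    have "cbr br x (cbr br y z) + cbr br y (cbr br z x) + cbr br z (cbr br x y) =
        (J x1 y1 z1 - J x1 y2 z2 - J x2 y1 z2 - J x2 y2 z1,
         J x1 y1 z2 + J x1 y2 z1 + J x2 y1 z1 - J x2 y2 z2)"
      by (simp add: cbr_def bil J_def)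
    then show "cbr br x (cbr br y z) + cbr br y (cbr br z x) + cbr br z (cbr br x y) = 0"
      by (simp add: J0 zero_prod_def)
  qed (simp_all add: cbr_def cscale_def bil scaleR_add_left scaleR_add_right scaleR_diff_left
      scaleR_diff_right)
qed


subsection \<open>Roots\<close>

type_synonym 'a functional = "'a complexification \<Rightarrow> complex"

text \<open>Elements of the dual space of the complexification \<open>t \<times> t\<close> of \<open>t\<close> are extended by zero, so that
  equality, sum and negation of functionals are those of functions.\<close>

definition cdual :: "'a::real_vector set \<Rightarrow> 'a functional set" where
  "cdual t = {\<alpha>. (\<forall>u\<in>t \<times> t. \<forall>v\<in>t \<times> t. \<alpha> (u + v) = \<alpha> u + \<alpha> v)
     \<and> (\<forall>z. \<forall>u\<in>t \<times> t. \<alpha> (cscale z u) = z * \<alpha> u) \<and> (\<forall>u. u \<notin> t \<times> t \<longrightarrow> \<alpha> u = 0)}"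

definition root_space ::
    "('a::real_vector \<Rightarrow> 'a \<Rightarrow> 'a) \<Rightarrow> 'a set \<Rightarrow> 'a functional \<Rightarrow> 'a complexification set" where
  "root_space br t \<alpha> =
     {u. \<forall>H\<in>t. cbr br (of_real_form H) u = cscale (\<alpha> (of_real_form H)) u}"

definition roots :: "('a::real_vector \<Rightarrow> 'a \<Rightarrow> 'a) \<Rightarrow> 'a set \<Rightarrow> 'a functional set" where
  "roots br t = {\<alpha> \<in> cdual t. \<alpha> \<noteq> 0 \<and> root_space br t \<alpha> \<noteq> {0}}"

text \<open>The description is proper in the situation of interest: for a Cartan subalgebra \<open>t\<close> of a compact
  Lie algebra the Killing form is negative definite on \<open>t\<close> and the roots are imaginary on \<open>t\<close>.\<close>

definition sharp ::
    "('a::real_vector \<Rightarrow> 'a \<Rightarrow> 'a) \<Rightarrow> 'a set \<Rightarrow> 'a functional \<Rightarrow> 'a complexification" where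
  "sharp br t \<alpha> = (THE u. u \<in> (\<lambda>H. cscale \<i> (of_real_form H)) ` t
     \<and> (\<forall>H\<in>t. killing cscale (cbr br) u (of_real_form H) = \<alpha> (of_real_form H)))"

definition positive_roots ::
    "('a::real_vector \<Rightarrow> 'a \<Rightarrow> 'a) \<Rightarrow> 'a set \<Rightarrow> 'a \<Rightarrow> 'a functional set" where
  "positive_roots br t H0 =
     {\<alpha> \<in> roots br t. \<exists>r::real. r > 0 \<and> \<alpha> (of_real_form H0) = \<i> * of_real r}"

definition simple_roots ::
    "('a::real_vector \<Rightarrow> 'a \<Rightarrow> 'a) \<Rightarrow> 'a set \<Rightarrow> 'a \<Rightarrow> 'a functional set" where
  "simple_roots br t H0 = {\<alpha> \<in> positive_roots br t H0.
     \<not> (\<exists>\<beta>\<in>positive_roots br t H0. \<exists>\<gamma>\<in>positive_roots br t H0. \<alpha> = \<beta> + \<gamma>)}"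


subsection \<open>Chevalley bases\<close>

text \<open>\<open>X\<close> is a Chevalley basis with Chevalley constants \<open>c\<close>. Only the values of \<open>X\<close> at roots and those
  of \<open>c\<close> at pairs of roots with non-zero sum are meaningful; the others are left unconstrained.\<close>

definition chevalley_basis :: "('a::real_vector \<Rightarrow> 'a \<Rightarrow> 'a) \<Rightarrow> 'a set
    \<Rightarrow> ('a functional \<Rightarrow> 'a complexification) \<Rightarrow> ('a functional \<Rightarrow> 'a functional \<Rightarrow> real) \<Rightarrow> bool" where
  "chevalley_basis br t X c \<longleftrightarrow>
     (\<forall>\<alpha>\<in>roots br t. X \<alpha> \<in> root_space br t \<alpha>) \<and>
     (\<forall>\<alpha>\<in>roots br t. \<forall>\<beta>\<in>roots br t.
        (\<alpha> + \<beta> \<in> roots br t \<longrightarrow>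
           cbr br (X \<alpha>) (X \<beta>) = cscale (of_real (c \<alpha> \<beta>)) (X (\<alpha> + \<beta>))) \<and>
        (\<alpha> + \<beta> = 0 \<longrightarrow> cbr br (X \<alpha>) (X \<beta>) = sharp br t \<alpha>) \<and>
        (\<alpha> + \<beta> \<notin> roots br t \<and> \<alpha> + \<beta> \<noteq> 0 \<longrightarrow> cbr br (X \<alpha>) (X \<beta>) = 0 \<and> c \<alpha> \<beta> = 0) \<and>
        (\<alpha> + \<beta> \<noteq> 0 \<longrightarrow> c (- \<alpha>) (- \<beta>) = - c \<alpha> \<beta>))"

end

theory Submission
  imports Defs
begin

text \<open>Choose root vectors of norm one for the Hermitian form \<open>- \<kappa>(u, conjugation v)\<close>, with
  \<open>X\<^bsub>-\<alpha>\<^esub> = - conjugation X\<^bsub>\<alpha>\<^esub>\<close>; then \<open>[X\<^bsub>\<alpha>\<^esub>, X\<^bsub>-\<alpha>\<^esub>] = \<alpha>\<^sup>\<sharp>\<close> and only phases remain free. The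
  coefficients \<open>N\<^bsub>\<alpha>,\<beta>\<^esub> = \<kappa>([X\<^bsub>\<alpha>\<^esub>, X\<^bsub>\<beta>\<^esub>], X\<^bsub>-\<alpha>-\<beta>\<^esub>)\<close> are antisymmetric and cyclic, satisfy
  \<open>N\<^bsub>-\<alpha>,-\<beta>\<^esub> = - cnj N\<^bsub>\<alpha>,\<beta>\<^esub>\<close>, and the Jacobi identity gives a quadratic relation among them for
  four roots with sum zero. Applied to \<open>\<alpha> + \<beta> = \<zeta> + \<eta>\<close>, it expresses \<open>N\<^bsub>\<alpha>,\<beta>\<^esub>\<close> by \<open>N\<^bsub>\<zeta>,\<eta>\<^esub>\<close> and
  coefficients of smaller height, so a system with these properties is determined by its non-zero
  values at the chosen pairs \<open>(\<zeta>, \<eta>)\<close>. Choosing the phases recursively makes these values positive;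
  comparison of \<open>N\<close> with its complex conjugate then shows that \<open>N\<close> is real. Two such bases differ by
  phases, so the positive values at the chosen pairs agree, hence all constants do.\<close>


subsection \<open>Traces and the Killing form\<close>

context vector_space
begin

text \<open>Expand each basis vector in the family \<open>e\<close>, exchange the two sums, and
  reassemble \<open>f (e i)\<close> from its basis coordinates. Only the expansion property of
  \<open>phi\<close> and \<open>e\<close> enters, so the trace over \<complex> can later be computed
  from a real basis.\<close>

lemma endo_trace_dual_system:
  assumes fin: "finite E" "span E = UNIV"
    and f: "Vector_Spaces.linear scale scale f"
    and I: "finite I"
    and phi_add: "\<And>i x y. i \<in> I \<Longrightarrow> phi i (x + y) = phi i x + phi i y"
    and phi_scale: "\<And>i a x. i \<in> I \<Longrightarrow> phi i (scale a x) = a * phi i x"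
    and expand: "\<And>x. x = (\<Sum>i\<in>I. scale (phi i x) (e i))"
  shows "endo_trace f = (\<Sum>i\<in>I. phi i (f (e i)))"
proof -
  let ?B = "extend_basis {}"
  have ind: "independent ?B" and spn: "span ?B = UNIV"
    using independent_extend_basis[OF independent_empty] span_extend_basis[OF independent_empty] by auto
  have finB: "finite ?B"
    using independent_span_bound[OF fin(1) ind] fin(2) by auto
  interpret f: Vector_Spaces.linear scale scale f by (fact f)
  have phi0: "phi i 0 = 0" if "i \<in> I" for i
    using phi_scale[OF that, of 0 0] by simp
  have phi_sum: "phi i (sum g S) = (\<Sum>b\<in>S. phi i (g b))" if "i \<in> I" "finite S" for i g S
    using that(2) by (induction S rule: finite_induct) (simp_all add: phi0 phi_add that)
  have rep: "(\<Sum>b\<in>?B. scale (representation ?B x b) b) = x" for x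
    using sum_representation_eq[OF ind _ finB subset_refl, of x] spn by simp
  have "endo_trace f = (\<Sum>b\<in>?B. representation ?B (f (\<Sum>i\<in>I. scale (phi i b) (e i))) b)"
    unfolding endo_trace_def using expand by simp
  also have "\<dots> = (\<Sum>b\<in>?B. \<Sum>i\<in>I. phi i b * representation ?B (f (e i)) b)"
    by (simp add: f.sum f.scale representation_sum[OF ind] representation_scale[OF ind] spn)
  also have "\<dots> = (\<Sum>i\<in>I. \<Sum>b\<in>?B. phi i b * representation ?B (f (e i)) b)"
    by (rule sum.swap)
  also have "\<dots> = (\<Sum>i\<in>I. phi i (\<Sum>b\<in>?B. scale (representation ?B (f (e i)) b) b))"
    by (intro sum.cong refl) (simp add: phi_sum finB phi_scale mult.commute)
  finally show ?thesis by (simp add: rep)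
qed

end

section \<open>Traces in a finite-dimensional Lie algebra\<close>

context lie_algebra
begin

lemma finite_extend_basis: "finite (extend_basis {})"
  and independent_extend_basis_empty: "independent (extend_basis {})"
  and span_extend_basis_empty: "span (extend_basis {}) = UNIV"
proof -
  show ind: "independent (extend_basis {})" and "span (extend_basis {}) = UNIV"
    using independent_extend_basis[OF independent_empty] span_extend_basis[OF independent_empty] by auto
  obtain E where "finite E" "span E = UNIV" using finite_dim by blast
  then show "finite (extend_basis {})" using independent_span_bound[OF _ ind] by auto
qed

lemmas rep_basis = finite_extend_basis independent_extend_basis_empty span_extend_basis_empty

lemma basis_expansion:
  "(\<Sum>b\<in>extend_basis {}. scale (representation (extend_basis {}) x b) b) = x"
  using sum_representation_eq[OF rep_basis(2) _ rep_basis(1) subset_refl, of x] rep_basis by simp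

lemma representation_extend_basis_simps:
  "representation (extend_basis {}) (x + y) b =
     representation (extend_basis {}) x b + representation (extend_basis {}) y b"
  "representation (extend_basis {}) (x - y) b =
     representation (extend_basis {}) x b - representation (extend_basis {}) y b"
  "representation (extend_basis {}) (scale a x) b = a * representation (extend_basis {}) x b"
  by (simp_all add: rep_basis representation_add representation_diff representation_scale)

lemma endo_trace_add: "endo_trace (\<lambda>x. f x + g x) = endo_trace f + endo_trace g"
  and endo_trace_diff: "endo_trace (\<lambda>x. f x - g x) = endo_trace f - endo_trace g"
  and endo_trace_scale: "endo_trace (\<lambda>x. scale a (f x)) = a * endo_trace f"
  by (simp_all add: endo_trace_def representation_extend_basis_simps sum.distrib sum_subtractf
      sum_distrib_left)

text \<open>In matrix entries both traces are the same double sum, taken in opposite orders.\<close>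

lemma endo_trace_compose_commute:
  assumes f: "Vector_Spaces.linear scale scale f" and g: "Vector_Spaces.linear scale scale g"
  shows "endo_trace (\<lambda>x. f (g x)) = endo_trace (\<lambda>x. g (f x))"
proof -
  let ?B = "extend_basis {}"
  interpret f: Vector_Spaces.linear scale scale f by (fact f)
  interpret g: Vector_Spaces.linear scale scale g by (fact g)
  have *: "endo_trace (\<lambda>x. h (k x)) =
      (\<Sum>b\<in>?B. \<Sum>c\<in>?B. representation ?B (k b) c * representation ?B (h c) b)"
    if "Vector_Spaces.linear scale scale h" for h k :: "'v \<Rightarrow> 'v"
  proof -
    interpret h: Vector_Spaces.linear scale scale h by (fact that)
    have "endo_trace (\<lambda>x. h (k x)) =
        (\<Sum>b\<in>?B. representation ?B (h (\<Sum>c\<in>?B. scale (representation ?B (k b) c) c)) b)"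
      unfolding endo_trace_def basis_expansion ..
    then show ?thesis
      by (simp add: h.sum h.scale rep_basis representation_sum representation_scale)
  qed
  have "(\<Sum>b\<in>?B. \<Sum>c\<in>?B. representation ?B (g b) c * representation ?B (f c) b) =
      (\<Sum>c\<in>?B. \<Sum>b\<in>?B. representation ?B (g b) c * representation ?B (f c) b)"
    by (rule sum.swap)
  then show ?thesis
    unfolding *[OF f] *[OF g] by (simp add: mult.commute)
qed

sublocale br_l: Vector_Spaces.linear scale scale "\<lambda>x. br x y" for y by (rule linear_br_left)
sublocale br_r: Vector_Spaces.linear scale scale "\<lambda>y. br x y" for x by (rule linear_br_right)

lemmas br_simps = br_l.add br_r.add br_l.diff br_r.diff br_l.neg br_r.neg br_l.scale br_r.scale
  br_l.zero br_r.zero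

lemma br_anti: "br y x = - br x y"
proof -
  have "br (x + y) (x + y) = br x y + br y x"
    by (simp add: br_l.add br_r.add br_self[of x] br_self[of y])
  then show ?thesis by (simp only: br_self) (simp add: eq_neg_iff_add_eq_0 add.commute)
qed

text \<open>The Jacobi identity, read as saying that bracketing with \<open>x\<close> is a
  derivation; it is used in this form throughout.\<close>

lemma br_derivation: "br x (br y z) = br (br x y) z + br y (br x z)"
  using jacobi[of x y z] by (simp add: br_anti[of z x] br_anti[of z "br x y"] br_r.neg algebra_simps)

lemma linear_br_br: "Vector_Spaces.linear scale scale (\<lambda>z. br x (br y z))"
  by unfold_locales (simp_all add: br_simps)

section \<open>Symmetry, bilinearity and invariance of the Killing form\<close>

lemma killing_eq_sum: "killing scale br x y =
    (\<Sum>b\<in>extend_basis {}. representation (extend_basis {}) (br x (br y b)) b)"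
  by (simp add: killing_def endo_trace_def)

lemma killing_sym: "killing scale br x y = killing scale br y x"
  unfolding killing_def by (rule endo_trace_compose_commute[OF linear_br_right linear_br_right])

lemma killing_add_left: "killing scale br (x + y) z = killing scale br x z + killing scale br y z"
  and killing_diff_left: "killing scale br (x - y) z = killing scale br x z - killing scale br y z"
  and killing_scale_left: "killing scale br (scale a x) z = a * killing scale br x z"
  by (simp_all add: killing_def br_simps endo_trace_add endo_trace_diff endo_trace_scale)

lemma killing_neg_left: "killing scale br (- x) z = - killing scale br x z"
  using killing_scale_left[of "-1" x z] by simp

lemma killing_zero_left: "killing scale br 0 z = 0"
  using killing_scale_left[of 0 0 z] by simp

lemma killing_add_right: "killing scale br z (x + y) = killing scale br z x + killing scale br z y"
  and killing_diff_right: "killing scale br z (x - y) = killing scale br z x - killing scale br z y"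
  and killing_scale_right: "killing scale br z (scale a x) = a * killing scale br z x"
  and killing_neg_right: "killing scale br z (- x) = - killing scale br z x"
  and killing_zero_right: "killing scale br z 0 = 0"
  unfolding killing_sym[of z]
  by (rule killing_add_left killing_diff_left killing_scale_left killing_neg_left killing_zero_left)+

lemmas killing_simps = killing_add_left killing_diff_left killing_scale_left killing_neg_left
  killing_zero_left killing_add_right killing_diff_right killing_scale_right killing_neg_right
  killing_zero_right

text \<open>The derivation rule makes ad \<open>[x, y]\<close> the commutator of ad \<open>x\<close>
  and ad \<open>y\<close>; invariance of the trace under cyclic permutation then moves ad
  \<open>y\<close> past ad \<open>x\<close> ad \<open>z\<close>, which leaves the commutator of ad
  \<open>y\<close> and ad \<open>z\<close>.\<close>

lemma killing_invariant: "killing scale br (br x y) z = killing scale br x (br y z)"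
proof -
  have "killing scale br (br x y) z =
      endo_trace (\<lambda>w. br x (br y (br z w)) - br y (br x (br z w)))"
    unfolding killing_def by (rule arg_cong[of _ _ endo_trace]) (simp add: br_derivation[of x y] fun_eq_iff)
  also have "\<dots> = endo_trace (\<lambda>w. br x (br y (br z w))) - endo_trace (\<lambda>w. br x (br z (br y w)))"
    by (simp add: endo_trace_diff endo_trace_compose_commute[OF linear_br_right linear_br_br, of y x z])
  also have "\<dots> = endo_trace (\<lambda>w. br x (br (br y z) w))"
    by (simp add: endo_trace_diff[symmetric] br_derivation[of y z] br_simps)
  finally show ?thesis by (simp add: killing_def)
qed

lemma killing_ad_skew: "killing scale br (br x y) z = - killing scale br y (br x z)"
  using killing_invariant[of y x z] by (simp add: br_anti[of x y] killing_simps)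

end


subsection \<open>Systems of structure constants\<close>

text \<open>Isolates what the comparison argument needs from bracket coefficients. Values are
  complex, since reality is only proved later by comparing a system with its conjugate. The last
  clause is the Jacobi identity paired with a fourth root vector; its inequalities exclude brackets
  that land in the Cartan subalgebra.\<close>

definition structure_constants :: "'b::ab_group_add set \<Rightarrow> ('b \<Rightarrow> 'b \<Rightarrow> complex) \<Rightarrow> bool" where
  "structure_constants R c \<longleftrightarrow>
     (\<forall>\<alpha> \<beta>. c \<beta> \<alpha> = - c \<alpha> \<beta>) \<and>
     (\<forall>\<alpha> \<beta> \<gamma>. \<alpha> + \<beta> + \<gamma> = 0 \<longrightarrow> c \<alpha> \<beta> = c \<beta> \<gamma>) \<and>
     (\<forall>\<alpha> \<beta>. c (- \<alpha>) (- \<beta>) = - cnj (c \<alpha> \<beta>)) \<and>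
     (\<forall>\<alpha> \<beta>. \<alpha> + \<beta> \<notin> R \<longrightarrow> c \<alpha> \<beta> = 0) \<and>
     (\<forall>\<alpha>\<in>R. \<forall>\<beta>\<in>R. \<forall>\<gamma>\<in>R. \<forall>\<delta>\<in>R. \<alpha> + \<beta> + \<gamma> + \<delta> = 0 \<longrightarrow>
        \<alpha> + \<beta> \<noteq> 0 \<longrightarrow> \<beta> + \<gamma> \<noteq> 0 \<longrightarrow> \<gamma> + \<alpha> \<noteq> 0 \<longrightarrow>
        c \<alpha> \<beta> * c \<gamma> \<delta> + c \<beta> \<gamma> * c \<alpha> \<delta> + c \<gamma> \<alpha> * c \<beta> \<delta> = 0)"

lemma structure_constantsD:
  assumes "structure_constants R c"
  shows structure_constants_anti: "c \<beta> \<alpha> = - c \<alpha> \<beta>"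
    and structure_constants_cyclic: "\<alpha> + \<beta> + \<gamma> = 0 \<Longrightarrow> c \<alpha> \<beta> = c \<beta> \<gamma>"
    and structure_constants_uminus: "c (- \<alpha>) (- \<beta>) = - cnj (c \<alpha> \<beta>)"
    and structure_constants_eq_0: "\<alpha> + \<beta> \<notin> R \<Longrightarrow> c \<alpha> \<beta> = 0"
    and structure_constants_four: "\<alpha> \<in> R \<Longrightarrow> \<beta> \<in> R \<Longrightarrow> \<gamma> \<in> R \<Longrightarrow> \<delta> \<in> R \<Longrightarrow> \<alpha> + \<beta> + \<gamma> + \<delta> = 0 \<Longrightarrow>
      \<alpha> + \<beta> \<noteq> 0 \<Longrightarrow> \<beta> + \<gamma> \<noteq> 0 \<Longrightarrow> \<gamma> + \<alpha> \<noteq> 0 \<Longrightarrow>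
      c \<alpha> \<beta> * c \<gamma> \<delta> + c \<beta> \<gamma> * c \<alpha> \<delta> + c \<gamma> \<alpha> * c \<beta> \<delta> = 0"
  using assms unfolding structure_constants_def by blast+

text \<open>All the relations have real coefficients, so conjugating each of them gives the same
  relation for the conjugate system.\<close>

lemma structure_constants_cnj:
  assumes "structure_constants R c"
  shows "structure_constants R (\<lambda>\<alpha> \<beta>. cnj (c \<alpha> \<beta>))"
  unfolding structure_constants_def
proof (intro conjI allI ballI impI)
  note c = structure_constantsD[OF assms]
  fix \<alpha> \<beta> \<gamma> \<delta>
  show "cnj (c \<beta> \<alpha>) = - cnj (c \<alpha> \<beta>)" using c(1)[of \<beta> \<alpha>] by simp
  show "cnj (c \<alpha> \<beta>) = cnj (c \<beta> \<gamma>)" if "\<alpha> + \<beta> + \<gamma> = 0" using c(2)[OF that] by simp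
  show "cnj (c (- \<alpha>) (- \<beta>)) = - cnj (cnj (c \<alpha> \<beta>))" using c(3)[of \<alpha> \<beta>] by simp
  show "cnj (c \<alpha> \<beta>) = 0" if "\<alpha> + \<beta> \<notin> R" using c(4)[OF that] by simp
  assume "\<alpha> \<in> R" "\<beta> \<in> R" "\<gamma> \<in> R" "\<delta> \<in> R" "\<alpha> + \<beta> + \<gamma> + \<delta> = 0"
    "\<alpha> + \<beta> \<noteq> 0" "\<beta> + \<gamma> \<noteq> 0" "\<gamma> + \<alpha> \<noteq> 0"
  from arg_cong[OF c(5)[OF this], of cnj]
  show "cnj (c \<alpha> \<beta>) * cnj (c \<gamma> \<delta>) + cnj (c \<beta> \<gamma>) * cnj (c \<alpha> \<delta>) + cnj (c \<gamma> \<alpha>) * cnj (c \<beta> \<delta>) = 0"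
    by simp
qed

section \<open>Determination of a system of constants by its values at chosen pairs\<close>

locale root_height =
  fixes R :: "'b::ab_group_add set" and h :: "'b \<Rightarrow> real"
  assumes finite_R: "finite R"
    and uminus_R: "\<alpha> \<in> R \<Longrightarrow> - \<alpha> \<in> R"
    and h_add: "h (\<alpha> + \<beta>) = h \<alpha> + h \<beta>"
    and h_nonzero: "\<alpha> \<in> R \<Longrightarrow> h \<alpha> \<noteq> 0"
begin

lemma h_zero: "h 0 = 0"
  using h_add[of 0 0] by simp

lemma h_uminus: "h (- \<alpha>) = - h \<alpha>"
  using h_add[of \<alpha> "- \<alpha>"] h_zero by simp

lemma h_diff: "h (\<alpha> - \<beta>) = h \<alpha> - h \<beta>"
  using h_add[of \<alpha> "- \<beta>"] h_uminus by simp

text \<open>Heights are arbitrary reals, so induction on them rests on finiteness of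
  \<open>R\<close>: the number of elements of smaller height strictly increases with the
  height.\<close>

lemma wf_height: "wf {(\<alpha>, \<beta>). \<alpha> \<in> R \<and> \<beta> \<in> R \<and> h \<alpha> < h \<beta>}"
proof (rule wf_subset)
  show "wf (measure (\<lambda>\<alpha>. card {\<gamma> \<in> R. h \<gamma> < h \<alpha>}))" by simp
  show "{(\<alpha>, \<beta>). \<alpha> \<in> R \<and> \<beta> \<in> R \<and> h \<alpha> < h \<beta>} \<subseteq> measure (\<lambda>\<alpha>. card {\<gamma> \<in> R. h \<gamma> < h \<alpha>})"
    by (auto intro!: psubset_card_mono simp: finite_R)
qed

text \<open>The three elements \<alpha>, -\<beta>, \<beta> - \<alpha> have sum zero. By the cyclic
  rule, and the sign rule if needed, the value becomes one at two positive elements whose sum is the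
  higher of \<alpha> and \<beta>, hence of height below \<open>r\<close>.\<close>

lemma structure_constants_eq_mixed:
  assumes c: "structure_constants R c" and c': "structure_constants R c'"
    and IH: "\<And>\<alpha> \<beta>. \<alpha> \<in> R \<Longrightarrow> \<beta> \<in> R \<Longrightarrow> h \<alpha> > 0 \<Longrightarrow> h \<beta> > 0 \<Longrightarrow> \<alpha> + \<beta> \<in> R \<Longrightarrow> h (\<alpha> + \<beta>) < r
      \<Longrightarrow> c \<alpha> \<beta> = c' \<alpha> \<beta>"
    and \<alpha>: "\<alpha> \<in> R" "0 < h \<alpha>" "h \<alpha> < r" and \<beta>: "\<beta> \<in> R" "0 < h \<beta>" "h \<beta> < r"
  shows "c \<alpha> (- \<beta>) = c' \<alpha> (- \<beta>)"
proof -
  consider "\<alpha> - \<beta> \<notin> R" | "\<alpha> - \<beta> \<in> R" "h (\<alpha> - \<beta>) > 0" | "\<beta> - \<alpha> \<in> R" "h (\<beta> - \<alpha>) > 0"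
    using h_nonzero[of "\<alpha> - \<beta>"] uminus_R[of "\<alpha> - \<beta>"] by (force simp: h_diff)
  then show ?thesis
  proof cases
    case 1
    then show ?thesis
      using structure_constants_eq_0[OF c, of \<alpha> "- \<beta>"] structure_constants_eq_0[OF c', of \<alpha> "- \<beta>"]
      by simp
  next
    case 2
    \<comment> \<open>Here \<alpha> is the higher one and splits as \<beta> + (\<alpha> -
      \<beta>).\<close>
    have "d \<alpha> (- \<beta>) = - cnj (d \<beta> (\<alpha> - \<beta>))" if "structure_constants R d" for d
    proof -
      have "d \<alpha> (- \<beta>) = d (- \<beta>) (- (\<alpha> - \<beta>))" by (rule structure_constants_cyclic[OF that]) simp
      then show ?thesis using structure_constants_uminus[OF that, of \<beta> "\<alpha> - \<beta>"] by simp
    qed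
    from this[OF c] this[OF c'] show ?thesis using IH[of \<beta> "\<alpha> - \<beta>"] 2 \<alpha> \<beta> by simp
  next
    case 3
    have "d \<alpha> (- \<beta>) = d (\<beta> - \<alpha>) \<alpha>" if "structure_constants R d" for d
      using structure_constants_cyclic[OF that, of \<alpha> "- \<beta>" "\<beta> - \<alpha>"] structure_constants_cyclic[OF that, of "- \<beta>" "\<beta> - \<alpha>" \<alpha>] by simp
    from this[OF c] this[OF c'] show ?thesis using IH[of "\<beta> - \<alpha>" \<alpha>] 3 \<alpha> \<beta> by simp
  qed
qed

text \<open>Induction on the height of \<alpha> + \<beta>. The relation for the four roots \<alpha>,
  \<beta>, -\<zeta>, -\<eta> expresses \<open>c \<alpha> \<beta>\<close> times the non-zero
  \<open>cnj (c \<zeta> \<eta>)\<close> by mixed values, which the induction hypothesis already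
  determines.\<close>

lemma structure_constants_eq_positive:
  assumes c: "structure_constants R c" and c': "structure_constants R c'"
    and agree: "\<And>\<alpha> \<beta>. \<alpha> \<in> R \<Longrightarrow> \<beta> \<in> R \<Longrightarrow> h \<alpha> > 0 \<Longrightarrow> h \<beta> > 0 \<Longrightarrow> \<alpha> + \<beta> \<in> R \<Longrightarrow>
      \<exists>\<zeta>\<in>R. \<exists>\<eta>\<in>R. h \<zeta> > 0 \<and> h \<eta> > 0 \<and> \<alpha> + \<beta> = \<zeta> + \<eta> \<and> c \<zeta> \<eta> = c' \<zeta> \<eta> \<and> c \<zeta> \<eta> \<noteq> 0"
  shows "\<alpha> \<in> R \<Longrightarrow> \<beta> \<in> R \<Longrightarrow> h \<alpha> > 0 \<Longrightarrow> h \<beta> > 0 \<Longrightarrow> \<alpha> + \<beta> \<in> R \<Longrightarrow> c \<alpha> \<beta> = c' \<alpha> \<beta>"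
proof (induction "\<alpha> + \<beta>" arbitrary: \<alpha> \<beta> rule: wf_induct_rule[OF wf_height])
  case (1 \<alpha> \<beta>)
  obtain \<zeta> \<eta> where R: "\<zeta> \<in> R" "\<eta> \<in> R" "h \<zeta> > 0" "h \<eta> > 0"
    and sum: "\<alpha> + \<beta> = \<zeta> + \<eta>" and eq: "c \<zeta> \<eta> = c' \<zeta> \<eta>" "c \<zeta> \<eta> \<noteq> 0"
    using agree 1(2-6) by blast
  show ?case
  \<comment> \<open>The four-root relation needs \<alpha> - \<zeta> and \<beta> - \<zeta> to be
    non-zero. In the excluded case the pair is the chosen one up to order, and antisymmetry
    suffices.\<close>
  proof (cases "\<alpha> = \<zeta> \<or> \<beta> = \<zeta>")
    case True
    then have "\<alpha> = \<zeta> \<and> \<beta> = \<eta> \<or> \<alpha> = \<eta> \<and> \<beta> = \<zeta>" using sum by (auto simp: add.commute)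
    then show ?thesis
      using eq structure_constants_anti[OF c, of \<eta> \<zeta>] structure_constants_anti[OF c', of \<eta> \<zeta>] by auto
  next
    case False
    have IH: "c \<mu> \<nu> = c' \<mu> \<nu>" if "\<mu> \<in> R" "\<nu> \<in> R" "h \<mu> > 0" "h \<nu> > 0" "\<mu> + \<nu> \<in> R"
      "h (\<mu> + \<nu>) < h (\<alpha> + \<beta>)" for \<mu> \<nu>
      using 1(1)[of \<mu> \<nu>] that 1(6) by simp
    have mixed: "c \<mu> (- \<nu>) = c' \<mu> (- \<nu>)"
      if "\<mu> \<in> R" "0 < h \<mu>" "h \<mu> < h (\<alpha> + \<beta>)" "\<nu> \<in> R" "0 < h \<nu>" "h \<nu> < h (\<alpha> + \<beta>)" for \<mu> \<nu>
      using structure_constants_eq_mixed[OF c c' IH that] .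
    have hs: "h \<alpha> + h \<beta> = h \<zeta> + h \<eta>" using arg_cong[OF sum, of h] by (simp add: h_add)
    have four: "d \<alpha> \<beta> * d (- \<zeta>) (- \<eta>) + d \<beta> (- \<zeta>) * d \<alpha> (- \<eta>) + d (- \<zeta>) \<alpha> * d \<beta> (- \<eta>) = 0"
      if "structure_constants R d" for d
    proof -
      have "\<alpha> + \<beta> + - \<zeta> + - \<eta> = 0" "\<alpha> + \<beta> \<noteq> 0" "\<beta> + - \<zeta> \<noteq> 0" "- \<zeta> + \<alpha> \<noteq> 0"
        using sum False 1(6) h_nonzero h_zero by (auto simp: algebra_simps)
      then show ?thesis
        using structure_constants_four[OF that 1(2,3) uminus_R[OF R(1)] uminus_R[OF R(2)]] by blast
    qed
    have rec: "d \<alpha> \<beta> * cnj (d \<zeta> \<eta>) = d \<beta> (- \<zeta>) * d \<alpha> (- \<eta>) - d \<alpha> (- \<zeta>) * d \<beta> (- \<eta>)"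
      if "structure_constants R d" for d
      using four[OF that] unfolding structure_constants_anti[OF that, of "- \<zeta>" \<alpha>]
        structure_constants_uminus[OF that, of \<zeta> \<eta>]
      by (simp add: algebra_simps)
    \<comment> \<open>Each of \<alpha>, \<beta>, \<zeta>, \<eta> is lower than the common sum, so
      \<open>mixed\<close> applies to every factor on the right of \<open>rec\<close>.\<close>
    have "c \<alpha> \<beta> * cnj (c \<zeta> \<eta>) = c' \<alpha> \<beta> * cnj (c' \<zeta> \<eta>)"
      unfolding rec[OF c] rec[OF c'] using 1(2-6) R hs
      by (simp add: mixed[of \<beta> \<zeta>] mixed[of \<alpha> \<zeta>] mixed[of \<alpha> \<eta>] mixed[of \<beta> \<eta>] h_add)
    then show ?thesis using eq by simp
  qed
qed

text \<open>Reduction to the positive case by signs: opposite signs are handled by the mixed lemma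
  and antisymmetry, two negative roots by the rule for
  \<open>c (- \<alpha>) (- \<beta>)\<close>.\<close>

theorem structure_constants_eq:
  assumes c: "structure_constants R c" and c': "structure_constants R c'"
    and agree: "\<And>\<alpha> \<beta>. \<alpha> \<in> R \<Longrightarrow> \<beta> \<in> R \<Longrightarrow> h \<alpha> > 0 \<Longrightarrow> h \<beta> > 0 \<Longrightarrow> \<alpha> + \<beta> \<in> R \<Longrightarrow>
      \<exists>\<zeta>\<in>R. \<exists>\<eta>\<in>R. h \<zeta> > 0 \<and> h \<eta> > 0 \<and> \<alpha> + \<beta> = \<zeta> + \<eta> \<and> c \<zeta> \<eta> = c' \<zeta> \<eta> \<and> c \<zeta> \<eta> \<noteq> 0"
    and \<alpha>: "\<alpha> \<in> R" and \<beta>: "\<beta> \<in> R"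
  shows "c \<alpha> \<beta> = c' \<alpha> \<beta>"
proof -
  have pos: "c \<mu> \<nu> = c' \<mu> \<nu>" if "\<mu> \<in> R" "\<nu> \<in> R" "h \<mu> > 0" "h \<nu> > 0" for \<mu> \<nu>
  proof (cases "\<mu> + \<nu> \<in> R")
    case True
    then show ?thesis using structure_constants_eq_positive[OF c c' agree] that by blast
  next
    case False
    then show ?thesis using structure_constants_eq_0[OF c] structure_constants_eq_0[OF c'] by simp
  qed
  have mixed: "c \<mu> (- \<nu>) = c' \<mu> (- \<nu>)" if "\<mu> \<in> R" "\<nu> \<in> R" "h \<mu> > 0" "h \<nu> > 0" for \<mu> \<nu>
    \<comment> \<open>Agreement at positive pairs is known at every height by now, so any bound
      above both heights will do.\<close>
    by (rule structure_constants_eq_mixed[OF c c', where r = "h \<mu> + h \<nu> + 1"]) (use pos that in auto)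
  have neg: "c (- \<mu>) (- \<nu>) = c' (- \<mu>) (- \<nu>)" if "c \<mu> \<nu> = c' \<mu> \<nu>" for \<mu> \<nu>
    using that by (simp add: structure_constants_uminus[OF c] structure_constants_uminus[OF c'])
  have anti: "c \<nu> \<mu> = c' \<nu> \<mu>" if "c \<mu> \<nu> = c' \<mu> \<nu>" for \<mu> \<nu>
    using that structure_constants_anti[OF c, of \<nu> \<mu>] structure_constants_anti[OF c', of \<nu> \<mu>] by simp
  have sgn: "h \<mu> > 0 \<or> - \<mu> \<in> R \<and> h (- \<mu>) > 0" if "\<mu> \<in> R" for \<mu>
    using h_nonzero[OF that] uminus_R[OF that] by (auto simp: h_uminus)
  show ?thesis
    using sgn[OF \<alpha>] sgn[OF \<beta>]
  proof (elim disjE)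
    assume "h \<alpha> > 0" "h \<beta> > 0"
    then show ?thesis using pos \<alpha> \<beta> by simp
  next
    assume "h \<alpha> > 0" "- \<beta> \<in> R \<and> h (- \<beta>) > 0"
    then show ?thesis using mixed[of \<alpha> "- \<beta>"] \<alpha> by simp
  next
    assume "- \<alpha> \<in> R \<and> h (- \<alpha>) > 0" "h \<beta> > 0"
    then show ?thesis using anti[OF mixed[of \<beta> "- \<alpha>"]] \<beta> by simp
  next
    assume "- \<alpha> \<in> R \<and> h (- \<alpha>) > 0" "- \<beta> \<in> R \<and> h (- \<beta>) > 0"
    then show ?thesis using neg[OF pos[of "- \<alpha>" "- \<beta>"]] by simp
  qed
qed

end


subsection \<open>Compact Lie algebras with a Cartan subalgebra\<close>

lemma conjugation_add: "conjugation (u + v) = conjugation u + conjugation v"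
  and conjugation_diff: "conjugation (u - v) = conjugation u - conjugation v"
  and conjugation_uminus: "conjugation (- u) = - conjugation u"
  and conjugation_zero [simp]: "conjugation 0 = 0"
  and conjugation_cscale: "conjugation (cscale z u) = cscale (cnj z) (conjugation u)"
  and conjugation_conjugation [simp]: "conjugation (conjugation u) = u"
  by (simp_all add: conjugation_def cscale_def prod_eq_iff)

lemma conjugation_of_real_form [simp]: "conjugation (of_real_form x) = of_real_form x"
  by (simp add: conjugation_def of_real_form_def)

lemma complexification_decompose: "u = of_real_form (fst u) + cscale \<i> (of_real_form (snd u))"
  by (simp add: of_real_form_def cscale_def)

lemma cdualD:
  assumes "\<alpha> \<in> cdual t"
  shows cdual_add: "u \<in> t \<times> t \<Longrightarrow> v \<in> t \<times> t \<Longrightarrow> \<alpha> (u + v) = \<alpha> u + \<alpha> v"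
    and cdual_cscale: "u \<in> t \<times> t \<Longrightarrow> \<alpha> (cscale z u) = z * \<alpha> u"
    and cdual_outside: "u \<notin> t \<times> t \<Longrightarrow> \<alpha> u = 0"
  using assms unfolding cdual_def by blast+

lemma uminus_cdual: "\<alpha> \<in> cdual t \<Longrightarrow> - \<alpha> \<in> cdual t"
  by (auto simp: cdual_def)

lemma add_cdual: "\<alpha> \<in> cdual t \<Longrightarrow> \<beta> \<in> cdual t \<Longrightarrow> \<alpha> + \<beta> \<in> cdual t"
  unfolding cdual_def by (simp add: algebra_simps)

locale compact_cartan =
  fixes br :: "'a::real_vector \<Rightarrow> 'a \<Rightarrow> 'a" and t :: "'a set"
  assumes compact: "compact_lie_algebra br"
    and cartan: "cartan_subalgebra br t"
begin

sublocale R: lie_algebra scaleR br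
  using compact unfolding compact_lie_algebra_def by blast

sublocale C: lie_algebra cscale "cbr br"
  by (rule lie_algebra_complexification) (rule R.lie_algebra_axioms)

abbreviation k :: "'a \<Rightarrow> 'a \<Rightarrow> real" where
  "k \<equiv> killing scaleR br"

abbreviation K :: "'a complexification \<Rightarrow> 'a complexification \<Rightarrow> complex" where
  "K \<equiv> killing cscale (cbr br)"

lemma k_negative: "x \<noteq> 0 \<Longrightarrow> k x x < 0"
  using compact unfolding compact_lie_algebra_def by blast

lemma k_nonpos: "k x x \<le> 0"
  using k_negative[of x] R.killing_zero_left[of x] by (cases "x = 0") auto

lemma k_eq_0: "k x x = 0 \<Longrightarrow> x = 0"
  using k_negative[of x] by (cases "x = 0") auto

text \<open>The complex Killing form is the complex bilinear extension of the real one: a real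
  basis, embedded in the complexification, expands every vector with the complex coordinates
  \<open>phi\<close>, so the complex trace can be taken over it.\<close>

lemma K_eq: "K u v = Complex (k (fst u) (fst v) - k (snd u) (snd v)) (k (fst u) (snd v) + k (snd u) (fst v))"
proof -
  let ?B = "vector_space.extend_basis scaleR {} :: 'a set"
  let ?r = "module.representation scaleR ?B"
  define phi :: "'a \<Rightarrow> 'a complexification \<Rightarrow> complex"
    where "phi b w = Complex (?r (fst w) b) (?r (snd w) b)" for b w
  obtain E where E: "finite E" "C.span E = UNIV" using C.finite_dim by blast
  have sum_prod: "(\<Sum>b\<in>S. (f b, g b)) = (sum f S, sum g S)" for S :: "'a set" and f g :: "'a \<Rightarrow> 'a"
    by (induction S rule: infinite_finite_induct) (simp_all add: zero_prod_def)
  have "K u v = (\<Sum>b\<in>?B. phi b (cbr br u (cbr br v (of_real_form b))))"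
    unfolding killing_def[of cscale]
  proof (rule C.endo_trace_dual_system[OF E C.linear_br_br R.rep_basis(1)])
    show "x = (\<Sum>b\<in>?B. cscale (phi b x) (of_real_form b))" for x
      by (simp add: phi_def cscale_def of_real_form_def sum_prod R.basis_expansion)
  qed (simp_all add: phi_def cscale_def R.representation_extend_basis_simps complex_eq_iff)
  then show ?thesis
    by (simp add: phi_def cbr_def of_real_form_def R.representation_extend_basis_simps R.killing_eq_sum complex_eq_iff
        R.br_simps sum.distrib sum_subtractf)
qed

lemma conjugation_cbr: "conjugation (cbr br u v) = cbr br (conjugation u) (conjugation v)"
  by (simp add: conjugation_def cbr_def R.br_simps)

lemma K_conjugation: "K (conjugation u) (conjugation v) = cnj (K u v)"
  by (simp add: K_eq conjugation_def R.killing_simps complex_eq_iff)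

lemma K_of_real_form: "K (of_real_form x) (of_real_form y) = of_real (k x y)"
  by (simp add: K_eq of_real_form_def R.killing_simps complex_eq_iff)

section \<open>The positive definite Hermitian form of the compact real form\<close>

definition herm :: "'a complexification \<Rightarrow> 'a complexification \<Rightarrow> complex" where
  "herm u v = - K u (conjugation v)"

lemma K_conjugation_right: "K u (conjugation v) = - herm u v"
  by (simp add: herm_def)

text \<open>The real number equal to \<open>herm u u\<close>, written so that its positivity is
  visible from the negative definiteness of \<open>k\<close>.\<close>

definition sqnorm :: "'a complexification \<Rightarrow> real" where
  "sqnorm u = - k (fst u) (fst u) - k (snd u) (snd u)"

lemma herm_self: "herm u u = of_real (sqnorm u)"
  using R.killing_sym[of "fst u" "snd u"]
  by (simp add: herm_def sqnorm_def K_eq conjugation_def R.killing_simps complex_eq_iff)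

lemma sqnorm_nonneg: "sqnorm u \<ge> 0"
  using k_nonpos[of "fst u"] k_nonpos[of "snd u"] by (simp add: sqnorm_def)

lemma sqnorm_eq_0: "sqnorm u = 0 \<longleftrightarrow> u = 0"
proof
  assume "sqnorm u = 0"
  then have "k (fst u) (fst u) = 0 \<and> k (snd u) (snd u) = 0"
    using k_nonpos[of "fst u"] k_nonpos[of "snd u"] by (simp add: sqnorm_def)
  then show "u = 0" using k_eq_0 by (simp add: prod_eq_iff)
qed (simp add: sqnorm_def R.killing_simps)

lemma sqnorm_pos: "u \<noteq> 0 \<Longrightarrow> sqnorm u > 0"
  using sqnorm_nonneg[of u] sqnorm_eq_0[of u] by simp

lemma herm_simps:
  "herm (u + v) w = herm u w + herm v w" "herm (u - v) w = herm u w - herm v w"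
  "herm (- u) w = - herm u w" "herm (cscale z u) w = z * herm u w" "herm 0 w = 0"
  "herm w (u + v) = herm w u + herm w v" "herm w (u - v) = herm w u - herm w v"
  "herm w (- u) = - herm w u" "herm w (cscale z u) = cnj z * herm w u" "herm w 0 = 0"
  by (simp_all add: herm_def C.killing_simps conjugation_add conjugation_diff conjugation_uminus
      conjugation_cscale)

text \<open>By invariance of the Killing form, the adjoint of ad \<open>u\<close> is minus ad of the
  conjugate of \<open>u\<close>. In particular ad \<open>H\<close> is skew-Hermitian for real
  \<open>H\<close>.\<close>

lemma herm_cbr: "herm (cbr br u v) w = - herm v (cbr br (conjugation u) w)"
  by (simp add: herm_def conjugation_cbr C.killing_ad_skew)

section \<open>The Cartan subalgebra and the Killing form on it\<close>

lemma t_subspace: "subspace t"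
  using cartan unfolding cartan_subalgebra_def subalgebra_def by blast

lemma t_zero: "0 \<in> t"
  by (rule subspace_0[OF t_subspace])

text \<open>An element centralizing \<open>t\<close> also normalizes it, and \<open>t\<close> is its
  own normalizer.\<close>

lemma centralizer_t:
  assumes "\<And>H. H \<in> t \<Longrightarrow> br H x = 0"
  shows "x \<in> t"
proof -
  have "x \<in> normalizer br t"
    using assms R.br_anti[of _ x] t_zero by (auto simp: normalizer_def)
  then show ?thesis using cartan unfolding cartan_subalgebra_def by simp
qed

lemma centralizer_complexified_t:
  assumes "\<And>H. H \<in> t \<Longrightarrow> cbr br (of_real_form H) u = 0"
  shows "u \<in> t \<times> t"
proof -
  have "fst u \<in> t" "snd u \<in> t"
    using assms by (auto intro!: centralizer_t simp: cbr_def of_real_form_def R.br_simps zero_prod_def)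
  then show ?thesis by (simp add: mem_Times_iff)
qed

text \<open>Real and imaginary parts of \<open>u\<close> lie in \<open>t\<close>, so each may be
  tested against itself, where \<open>k\<close> is definite.\<close>

lemma K_nondegenerate_t:
  assumes u: "u \<in> t \<times> t" and "\<And>H. H \<in> t \<Longrightarrow> K u (of_real_form H) = 0"
  shows "u = 0"
proof -
  have "k (fst u) H = 0" "k (snd u) H = 0" if "H \<in> t" for H
    using assms(2)[OF that] by (simp_all add: K_eq of_real_form_def R.killing_simps complex_eq_iff)
  then show ?thesis using u k_eq_0 by (auto simp: prod_eq_iff mem_Times_iff)
qed

text \<open>Gram-Schmidt by induction on the spanning set: the representative for
  \<open>span B\<close> is corrected along the component of the new vector orthogonal to
  \<open>span B\<close>.\<close>

lemma riesz_span:
  assumes "finite B" "B \<subseteq> t"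
    and "\<And>x y. x \<in> t \<Longrightarrow> y \<in> t \<Longrightarrow> f (x + y) = f x + f y"
    and "\<And>a x. x \<in> t \<Longrightarrow> f (a *\<^sub>R x) = a * f x"
  shows "\<exists>a\<in>span B. \<forall>x\<in>span B. k a x = f x"
  using assms
proof (induction B arbitrary: f rule: finite_induct)
  case empty
  have "f 0 = 0" using empty(3)[of 0 0] t_zero by simp
  then show ?case by (simp add: R.killing_simps)
next
  case (insert b B)
  have sub: "span B \<subseteq> t" using insert.prems(1) t_subspace by (simp add: span_minimal)
  have b: "b \<in> t" using insert.prems(1) by simp
  obtain a where a: "a \<in> span B" "\<And>x. x \<in> span B \<Longrightarrow> k a x = f x"
    using insert.IH[of f] insert.prems by auto
  \<comment> \<open>The orthogonal projection of \<open>b\<close> to \<open>span B\<close>, obtained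
    as the vector that represents the functional \<open>k b\<close> there.\<close>
  obtain p where p: "p \<in> span B" "\<And>x. x \<in> span B \<Longrightarrow> k p x = k b x"
    using insert.IH[of "k b"] insert.prems(1) by (auto simp: R.killing_simps)
  define b' where "b' = b - p"
  have b't: "b' \<in> t" using b p(1) sub t_subspace by (auto simp: b'_def subspace_diff)
  have orth: "k b' x = 0" if "x \<in> span B" for x
    using p(2)[OF that] by (simp add: b'_def R.killing_simps)
  \<comment> \<open>The coefficient is chosen to give \<open>k a' b' = f b'\<close>; values on
    \<open>span B\<close> are unaffected by orthogonality. If \<open>b' = 0\<close>, the correction
    vanishes and both sides are zero.\<close>
  define a' where "a' = a + (f b' / k b' b') *\<^sub>R b'"
  have sp: "span B \<subseteq> span (insert b B)" by (rule span_mono) auto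
  have b's: "b' \<in> span (insert b B)"
    unfolding b'_def using p(1) sp by (auto intro!: span_diff intro: span_base)
  have "k a' b' = f b'"
  proof (cases "b' = 0")
    case True
    then show ?thesis using insert.prems(3)[of 0 0] t_zero by (simp add: R.killing_simps)
  next
    case False
    then show ?thesis using orth[OF a(1)] k_negative[OF False] R.killing_sym[of a b']
      by (simp add: a'_def R.killing_simps)
  qed
  moreover have "k a' x = f x" if "x \<in> span B" for x
    using orth[OF that] a(2)[OF that] by (simp add: a'_def R.killing_simps)
  ultimately have "k a' x = f x" if x: "x \<in> span (insert b B)" for x
  proof -
    obtain c where c: "x - c *\<^sub>R b \<in> span B" using x by (auto simp: span_insert)
    define y where "y = (x - c *\<^sub>R b) + c *\<^sub>R p"
    have y: "y \<in> span B" unfolding y_def using c p(1) by (intro span_add span_scale)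
    have "x = c *\<^sub>R b' + y" by (simp add: b'_def y_def algebra_simps)
    moreover have "f (c *\<^sub>R b' + y) = c * f b' + f y"
      using insert.prems(2)[of "c *\<^sub>R b'" y] insert.prems(3)[of b' c] b't y sub t_subspace
      by (auto simp: subspace_scale)
    ultimately show ?thesis
      using \<open>k a' b' = f b'\<close> \<open>\<And>x. x \<in> span B \<Longrightarrow> k a' x = f x\<close>[OF y]
      by (simp add: R.killing_simps)
  qed
  moreover have "a' \<in> span (insert b B)"
    unfolding a'_def using a(1) sp b's by (auto intro!: span_add span_scale)
  ultimately show ?case by blast
qed

lemma riesz_t:
  assumes "\<And>x y. x \<in> t \<Longrightarrow> y \<in> t \<Longrightarrow> f (x + y) = f x + f y"
    and "\<And>a x. x \<in> t \<Longrightarrow> f (a *\<^sub>R x) = a * f x"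
  shows "\<exists>a\<in>t. \<forall>x\<in>t. k a x = f x"
proof -
  obtain E where E: "finite E" "span E = (UNIV :: 'a set)"
    using R.finite_dim unfolding span_raw_def by blast
  obtain B where B: "B \<subseteq> t" "independent B" "t \<subseteq> span B"
    using maximal_independent_subset[of t] by blast
  have "finite B" using independent_span_bound[OF E(1) B(2)] E(2) by simp
  moreover have "span B = t" using B t_subspace by (simp add: span_minimal subset_antisym)
  ultimately show ?thesis using riesz_span[of B f] B(1) assms by simp
qed

end


subsection \<open>Root spaces\<close>

context compact_cartan
begin

lemma rootsD:
  assumes "\<alpha> \<in> roots br t"
  shows roots_cdual: "\<alpha> \<in> cdual t" and roots_nonzero: "\<alpha> \<noteq> 0"
  using assms unfolding roots_def by auto

lemma of_real_form_t: "H \<in> t \<Longrightarrow> of_real_form H \<in> t \<times> t"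
  using t_zero by (simp add: of_real_form_def)

lemma cdual_decompose:
  assumes "\<alpha> \<in> cdual t" and "T \<in> t \<times> t"
  shows "\<alpha> T = \<alpha> (of_real_form (fst T)) + \<i> * \<alpha> (of_real_form (snd T))"
proof -
  have "of_real_form (fst T) \<in> t \<times> t" "of_real_form (snd T) \<in> t \<times> t"
    using assms(2) by (auto intro: of_real_form_t)
  moreover from this have "cscale \<i> (of_real_form (snd T)) \<in> t \<times> t"
    using subspace_neg[OF t_subspace] t_zero by (auto simp: cscale_def of_real_form_def mem_Times_iff)
  ultimately show ?thesis
    using complexification_decompose[of T] cdual_add[OF assms(1)] cdual_cscale[OF assms(1)] by metis
qed

lemma cdual_eqI:
  assumes "\<alpha> \<in> cdual t" "\<beta> \<in> cdual t"
    and "\<And>H. H \<in> t \<Longrightarrow> \<alpha> (of_real_form H) = \<beta> (of_real_form H)"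
  shows "\<alpha> = \<beta>"
proof
  fix T
  show "\<alpha> T = \<beta> T"
  proof (cases "T \<in> t \<times> t")
    case True
    then show ?thesis using assms by (simp add: cdual_decompose mem_Times_iff)
  next
    case False
    then show ?thesis using cdual_outside[OF assms(1)] cdual_outside[OF assms(2)] by simp
  qed
qed

lemma root_space_cbr:
  assumes "u \<in> root_space br t \<alpha>" "\<alpha> \<in> cdual t" "T \<in> t \<times> t"
  shows "cbr br T u = cscale (\<alpha> T) u"
proof -
  have "fst T \<in> t" "snd T \<in> t" using assms(3) by (auto simp: mem_Times_iff)
  then have *: "cbr br (of_real_form (fst T)) u = cscale (\<alpha> (of_real_form (fst T))) u"
    "cbr br (of_real_form (snd T)) u = cscale (\<alpha> (of_real_form (snd T))) u"
    using assms(1) unfolding root_space_def by blast+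
  have "cbr br T u = cbr br (of_real_form (fst T) + cscale \<i> (of_real_form (snd T))) u"
    using complexification_decompose[of T] by simp
  also have "\<dots> = cscale (\<alpha> T) u"
    by (simp add: C.br_l.add C.br_l.scale * cdual_decompose[OF assms(2,3)] C.scale_left_distrib)
  finally show ?thesis .
qed

lemma root_space_scale: "u \<in> root_space br t \<alpha> \<Longrightarrow> cscale z u \<in> root_space br t \<alpha>"
  unfolding root_space_def by (simp add: C.br_r.scale mult.commute)

lemma root_space_diff:
  "u \<in> root_space br t \<alpha> \<Longrightarrow> v \<in> root_space br t \<alpha> \<Longrightarrow> u - v \<in> root_space br t \<alpha>"
  unfolding root_space_def by (simp add: C.br_r.diff C.scale_right_diff_distrib)

lemma root_space_uminus: "u \<in> root_space br t \<alpha> \<Longrightarrow> - u \<in> root_space br t \<alpha>"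
  unfolding root_space_def by (simp add: C.br_r.neg)

text \<open>Each ad \<open>H\<close> is a derivation, so eigenvalues add. The sum need not be a
  root; the case of sum zero is used for brackets of opposite root vectors.\<close>

lemma root_space_add:
  assumes "u \<in> root_space br t \<alpha>" "v \<in> root_space br t \<beta>"
  shows "cbr br u v \<in> root_space br t (\<alpha> + \<beta>)"
  using assms unfolding root_space_def
  by (simp add: C.br_derivation[of _ u v] C.br_l.scale C.br_r.scale C.scale_left_distrib)

lemma root_vector_exists:
  assumes "\<alpha> \<in> roots br t"
  obtains u where "u \<in> root_space br t \<alpha>" "u \<noteq> 0"
proof -
  have "0 \<in> root_space br t \<alpha>" unfolding root_space_def by (simp add: C.br_r.zero)
  then show ?thesis using assms that unfolding roots_def by blast
qed

section \<open>Unit root vectors, conjugation and orthogonality\<close>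

lemma sqnorm_cscale: "sqnorm (cscale z u) = (cmod z)\<^sup>2 * sqnorm u"
proof -
  have "complex_of_real (sqnorm (cscale z u)) = z * cnj z * of_real (sqnorm u)"
    by (simp add: herm_self[symmetric] herm_simps)
  also have "\<dots> = of_real ((cmod z)\<^sup>2 * sqnorm u)"
    by (simp only: complex_norm_square[symmetric] of_real_mult)
  finally show ?thesis using of_real_eq_iff by blast
qed

definition normalized :: "'a complexification \<Rightarrow> 'a complexification" where
  "normalized u = cscale (of_real (1 / sqrt (sqnorm u))) u"

lemma sqnorm_normalized: "u \<noteq> 0 \<Longrightarrow> sqnorm (normalized u) = 1"
  using sqnorm_pos[of u] by (simp add: normalized_def sqnorm_cscale norm_divide power_divide)

lemma herm_normalized: "herm u (normalized u) = of_real (sqrt (sqnorm u))"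
proof -
  have "herm u (normalized u) = of_real (sqnorm u / sqrt (sqnorm u))"
    by (simp add: normalized_def herm_simps herm_self)
  then show ?thesis by (simp only: real_div_sqrt[OF sqnorm_nonneg])
qed

lemma normalized_root_space: "u \<in> root_space br t \<alpha> \<Longrightarrow> normalized u \<in> root_space br t \<alpha>"
  unfolding normalized_def by (rule root_space_scale)

lemma unit_root_vector_exists:
  assumes "\<alpha> \<in> roots br t"
  obtains u where "u \<in> root_space br t \<alpha>" "sqnorm u = 1"
proof -
  obtain u where "u \<in> root_space br t \<alpha>" "u \<noteq> 0" using root_vector_exists[OF assms] .
  then show ?thesis using that normalized_root_space sqnorm_normalized by blast
qed

text \<open>The values are eigenvalues of the skew-Hermitian map ad \<open>H\<close>; pair
  \<open>[H, u]\<close> with a unit root vector \<open>u\<close> and move ad \<open>H\<close> to the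
  other side.\<close>

lemma root_imaginary:
  assumes \<alpha>: "\<alpha> \<in> roots br t" and H: "H \<in> t"
  shows "cnj (\<alpha> (of_real_form H)) = - \<alpha> (of_real_form H)"
proof -
  obtain u where u: "u \<in> root_space br t \<alpha>" "sqnorm u = 1" using unit_root_vector_exists[OF \<alpha>] .
  have "cbr br (of_real_form H) u = cscale (\<alpha> (of_real_form H)) u"
    using u(1) H unfolding root_space_def by blast
  then have "\<alpha> (of_real_form H) * herm u u = - (cnj (\<alpha> (of_real_form H)) * herm u u)"
    using herm_cbr[of "of_real_form H" u u] by (simp add: herm_simps)
  then show ?thesis using u(2) by (simp add: herm_self) (metis minus_minus)
qed

lemma conjugation_root_space:
  assumes \<alpha>: "\<alpha> \<in> roots br t" and u: "u \<in> root_space br t \<alpha>"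
  shows "conjugation u \<in> root_space br t (- \<alpha>)"
  unfolding root_space_def
proof (intro CollectI ballI)
  fix H assume H: "H \<in> t"
  have "cbr br (of_real_form H) (conjugation u) = conjugation (cbr br (of_real_form H) u)"
    by (simp add: conjugation_cbr)
  also have "\<dots> = cscale ((- \<alpha>) (of_real_form H)) (conjugation u)"
    using u H root_imaginary[OF \<alpha> H] unfolding root_space_def by (simp add: conjugation_cscale)
  finally show "cbr br (of_real_form H) (conjugation u) = cscale ((- \<alpha>) (of_real_form H)) (conjugation u)" .
qed

lemma sqnorm_conjugation: "sqnorm (conjugation u) = sqnorm u"
  by (simp add: sqnorm_def conjugation_def R.killing_simps)

lemma rootsI: "\<alpha> \<in> cdual t \<Longrightarrow> \<alpha> \<noteq> 0 \<Longrightarrow> u \<in> root_space br t \<alpha> \<Longrightarrow> u \<noteq> 0 \<Longrightarrow> \<alpha> \<in> roots br t"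
  unfolding roots_def by blast

lemma uminus_roots:
  assumes \<alpha>: "\<alpha> \<in> roots br t"
  shows "- \<alpha> \<in> roots br t"
proof -
  obtain u where u: "u \<in> root_space br t \<alpha>" "sqnorm u = 1" using unit_root_vector_exists[OF \<alpha>] .
  have "conjugation u \<noteq> 0" using u(2) sqnorm_eq_0[of "conjugation u"] sqnorm_conjugation[of u] by simp
  then show ?thesis
    using rootsI conjugation_root_space[OF \<alpha> u(1)] uminus_cdual rootsD[OF \<alpha>]
    by (metis neg_equal_0_iff_equal)
qed

text \<open>A non-zero bracket would be a root vector for the non-zero functional \<alpha> + \<beta>
  and thus make it a root.\<close>

lemma cbr_root_spaces_eq_0:
  assumes "\<alpha> \<in> roots br t" "\<beta> \<in> roots br t" "\<alpha> + \<beta> \<notin> roots br t" "\<alpha> + \<beta> \<noteq> 0"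
    and "u \<in> root_space br t \<alpha>" "v \<in> root_space br t \<beta>"
  shows "cbr br u v = 0"
  using rootsI[OF add_cdual[OF roots_cdual[OF assms(1)] roots_cdual[OF assms(2)]]]
    root_space_add[OF assms(5,6)] assms(3,4) by blast

text \<open>Eigenvectors of a skew-Hermitian map with different eigenvalues are orthogonal; two
  distinct roots differ at some \<open>H\<close> in \<open>t\<close>.\<close>

lemma root_spaces_orthogonal:
  assumes \<alpha>: "\<alpha> \<in> roots br t" and \<beta>: "\<beta> \<in> roots br t" and "\<alpha> \<noteq> \<beta>"
    and u: "u \<in> root_space br t \<alpha>" and v: "v \<in> root_space br t \<beta>"
  shows "herm u v = 0"
proof (rule ccontr)
  assume nz: "herm u v \<noteq> 0"
  have "\<alpha> (of_real_form H) = \<beta> (of_real_form H)" if H: "H \<in> t" for H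
  proof -
    have "\<alpha> (of_real_form H) * herm u v = - (cnj (\<beta> (of_real_form H)) * herm u v)"
      using herm_cbr[of "of_real_form H" u v] u v H unfolding root_space_def by (simp add: herm_simps)
    then show ?thesis using nz root_imaginary[OF \<beta> H] by simp
  qed
  then show False using cdual_eqI[OF roots_cdual[OF \<alpha>] roots_cdual[OF \<beta>]] \<open>\<alpha> \<noteq> \<beta>\<close> by blast
qed

lemma orthonormal_independent:
  assumes unit: "\<And>u. u \<in> S \<Longrightarrow> sqnorm u = 1"
    and orth: "\<And>u v. u \<in> S \<Longrightarrow> v \<in> S \<Longrightarrow> u \<noteq> v \<Longrightarrow> herm u v = 0"
  shows "C.independent S"
  unfolding C.independent_explicit_module
proof (intro allI impI)
  fix A a v assume A: "finite A" "A \<subseteq> S" "(\<Sum>u\<in>A. cscale (a u) u) = 0" "v \<in> A"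
  have "herm (\<Sum>u\<in>A. cscale (a u) u) v = (\<Sum>u\<in>A. a u * herm u v)"
    using A(1) by (induction A rule: finite_induct) (simp_all add: herm_simps)
  also have "\<dots> = (\<Sum>u\<in>A. if u = v then a v else 0)"
  proof (rule sum.cong[OF refl])
    fix u assume "u \<in> A"
    then have "u \<in> S" "v \<in> S" using A by auto
    then show "a u * herm u v = (if u = v then a v else 0)"
      using unit[of v] orth[of u v] by (simp add: herm_self)
  qed
  finally show "a v = 0" using A by (simp add: herm_simps)
qed

text \<open>One unit root vector for each root gives an orthonormal, hence independent, family in a
  finite-dimensional space.\<close>

lemma finite_roots: "finite (roots br t)"
proof -
  define X where "X \<alpha> = (SOME u. u \<in> root_space br t \<alpha> \<and> sqnorm u = 1)" for \<alpha>
  have X: "X \<alpha> \<in> root_space br t \<alpha> \<and> sqnorm (X \<alpha>) = 1" if "\<alpha> \<in> roots br t" for \<alpha>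
    unfolding X_def by (rule someI_ex) (use unit_root_vector_exists[OF that] in blast)
  have orth: "herm (X \<alpha>) (X \<beta>) = 0" if "\<alpha> \<in> roots br t" "\<beta> \<in> roots br t" "\<alpha> \<noteq> \<beta>" for \<alpha> \<beta>
    using root_spaces_orthogonal[OF that] X that by blast
  have inj: "inj_on X (roots br t)"
  proof (rule inj_onI, rule ccontr)
    fix \<alpha> \<beta> assume "\<alpha> \<in> roots br t" "\<beta> \<in> roots br t" "X \<alpha> = X \<beta>" "\<alpha> \<noteq> \<beta>"
    then show False using orth[of \<alpha> \<beta>] X[of \<beta>] by (simp add: herm_self)
  qed
  have ind: "C.independent (X ` roots br t)"
  proof (rule orthonormal_independent)
    show "sqnorm u = 1" if "u \<in> X ` roots br t" for u using X that by blast
    show "herm u v = 0" if "u \<in> X ` roots br t" "v \<in> X ` roots br t" "u \<noteq> v" for u v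
      using orth that by blast
  qed
  obtain E where "finite E" "C.span E = UNIV" using C.finite_dim by blast
  then have "finite (X ` roots br t)" using C.independent_span_bound[OF _ ind] by auto
  then show ?thesis using inj by (rule finite_imageD)
qed

section \<open>The vectors dual to the roots\<close>

lemma sharp_ex1:
  assumes \<alpha>: "\<alpha> \<in> roots br t"
  shows "\<exists>!u. u \<in> (\<lambda>H. cscale \<i> (of_real_form H)) ` t
     \<and> (\<forall>H\<in>t. K u (of_real_form H) = \<alpha> (of_real_form H))"
proof -
  note cd = roots_cdual[OF \<alpha>]
  \<comment> \<open>Since \<alpha> is imaginary on \<open>t\<close>, it is \<i> times its imaginary
    part; if \<open>a\<close> represents the latter, then \<i> times \<open>a\<close> represents
    \<alpha>.\<close>
  have "\<exists>a\<in>t. \<forall>H\<in>t. k a H = Im (\<alpha> (of_real_form H))"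
  proof (rule riesz_t)
    show "Im (\<alpha> (of_real_form (x + y))) = Im (\<alpha> (of_real_form x)) + Im (\<alpha> (of_real_form y))"
      if "x \<in> t" "y \<in> t" for x y
    proof -
      have "of_real_form (x + y) = of_real_form x + of_real_form y" by (simp add: of_real_form_def)
      then show ?thesis using cdual_add[OF cd of_real_form_t[OF that(1)] of_real_form_t[OF that(2)]] by simp
    qed
    show "Im (\<alpha> (of_real_form (a *\<^sub>R x))) = a * Im (\<alpha> (of_real_form x))" if "x \<in> t" for a x
    proof -
      have "of_real_form (a *\<^sub>R x) = cscale (of_real a) (of_real_form x)"
        by (simp add: of_real_form_def cscale_def)
      then show ?thesis using cdual_cscale[OF cd of_real_form_t[OF that]] by simp
    qed
  qed
  then obtain a where a: "a \<in> t" "\<And>H. H \<in> t \<Longrightarrow> k a H = Im (\<alpha> (of_real_form H))" by blast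
  have im: "\<i> * of_real (Im (\<alpha> (of_real_form H))) = \<alpha> (of_real_form H)" if "H \<in> t" for H
    using root_imaginary[OF \<alpha> that] by (simp add: complex_eq_iff)
  show ?thesis
  proof (rule ex1I[of _ "cscale \<i> (of_real_form a)"])
    show "cscale \<i> (of_real_form a) \<in> (\<lambda>H. cscale \<i> (of_real_form H)) ` t \<and>
        (\<forall>H\<in>t. K (cscale \<i> (of_real_form a)) (of_real_form H) = \<alpha> (of_real_form H))"
      using a im by (auto simp: C.killing_simps K_of_real_form)
  next
    fix u assume u: "u \<in> (\<lambda>H. cscale \<i> (of_real_form H)) ` t \<and>
        (\<forall>H\<in>t. K u (of_real_form H) = \<alpha> (of_real_form H))"
    then obtain b where b: "b \<in> t" "u = cscale \<i> (of_real_form b)" by blast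
    have "u - cscale \<i> (of_real_form a) = 0"
    proof (rule K_nondegenerate_t)
      show "u - cscale \<i> (of_real_form a) \<in> t \<times> t"
        using a(1) b t_subspace t_zero by (auto simp: cscale_def of_real_form_def subspace_diff subspace_neg)
      show "K (u - cscale \<i> (of_real_form a)) (of_real_form H) = 0" if "H \<in> t" for H
        using u that a(2)[OF that] im[OF that] by (simp add: C.killing_simps K_of_real_form)
    qed
    then show "u = cscale \<i> (of_real_form a)" by simp
  qed
qed

abbreviation shp :: "'a functional \<Rightarrow> 'a complexification" where
  "shp \<equiv> sharp br t"

lemma
  assumes "\<alpha> \<in> roots br t"
  shows sharp_range: "shp \<alpha> \<in> (\<lambda>H. cscale \<i> (of_real_form H)) ` t"
    and K_sharp: "H \<in> t \<Longrightarrow> K (shp \<alpha>) (of_real_form H) = \<alpha> (of_real_form H)"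
  using theI'[OF sharp_ex1[OF assms]] unfolding sharp_def by blast+

lemma sharp_t: "\<alpha> \<in> roots br t \<Longrightarrow> shp \<alpha> \<in> t \<times> t"
  using sharp_range[of \<alpha>] t_zero subspace_neg[OF t_subspace] by (auto simp: cscale_def of_real_form_def)

lemma sharp_uminus:
  assumes \<alpha>: "\<alpha> \<in> roots br t"
  shows "shp (- \<alpha>) = - shp \<alpha>"
proof -
  note \<alpha>' = uminus_roots[OF \<alpha>]
  have "shp (- \<alpha>) + shp \<alpha> = 0"
  proof (rule K_nondegenerate_t)
    show "shp (- \<alpha>) + shp \<alpha> \<in> t \<times> t"
      using sharp_t[OF \<alpha>] sharp_t[OF \<alpha>'] subspace_add[OF t_subspace] by (auto simp: mem_Times_iff)
  qed (simp add: C.killing_simps K_sharp \<alpha> \<alpha>')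
  then show ?thesis by (simp add: eq_neg_iff_add_eq_0)
qed

text \<open>Writing \<open>shp \<alpha>\<close> as \<i> times \<open>a\<close> with \<open>a\<close>
  in \<open>t\<close>, the value of \<alpha> there is \<open>- k a a\<close>, and \<open>a\<close>
  is non-zero because \<alpha> is.\<close>

lemma root_sharp_pos:
  assumes \<alpha>: "\<alpha> \<in> roots br t"
  shows "Re (\<alpha> (shp \<alpha>)) > 0"
proof -
  obtain a where a: "a \<in> t" "shp \<alpha> = cscale \<i> (of_real_form a)" using sharp_range[OF \<alpha>] by blast
  have *: "\<i> * of_real (k a H) = \<alpha> (of_real_form H)" if "H \<in> t" for H
    using K_sharp[OF \<alpha> that] by (simp add: a(2) C.killing_simps K_of_real_form)
  have "a \<noteq> 0"
  proof
    assume "a = 0"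
    then have "\<alpha> (of_real_form H) = 0" if "H \<in> t" for H using *[OF that] by (simp add: R.killing_simps)
    then have "\<alpha> = 0" by (intro cdual_eqI roots_cdual[OF \<alpha>]) (auto simp: cdual_def)
    then show False using roots_nonzero[OF \<alpha>] by simp
  qed
  moreover have "\<alpha> (shp \<alpha>) = - of_real (k a a)"
    using cdual_cscale[OF roots_cdual[OF \<alpha>] of_real_form_t[OF a(1)], of \<i>] *[OF a(1), symmetric]
    by (simp add: a(2))
  ultimately show ?thesis using k_negative[of a] by simp
qed

lemma sharp_nonzero:
  assumes \<alpha>: "\<alpha> \<in> roots br t"
  shows "shp \<alpha> \<noteq> 0"
proof
  assume "shp \<alpha> = 0"
  moreover have "\<alpha> 0 = 0"
    using cdual_add[OF roots_cdual[OF \<alpha>], of 0 0] t_zero by (simp add: zero_prod_def)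
  ultimately show False using root_sharp_pos[OF \<alpha>] by simp
qed

text \<open>The bracket has weight zero, so it centralizes \<open>t\<close> and lies in its
  complexification. There it is identified by pairing with each \<open>H\<close>, using invariance
  of the Killing form.\<close>

lemma cbr_opposite_root_spaces:
  assumes \<alpha>: "\<alpha> \<in> roots br t" and u: "u \<in> root_space br t \<alpha>" and v: "v \<in> root_space br t (- \<alpha>)"
  shows "cbr br u v = cscale (K u v) (shp \<alpha>)"
proof -
  have "cbr br u v - cscale (K u v) (shp \<alpha>) = 0"
  proof (rule K_nondegenerate_t)
    have "cbr br u v \<in> t \<times> t"
    proof (rule centralizer_complexified_t)
      fix H assume "H \<in> t"
      then show "cbr br (of_real_form H) (cbr br u v) = 0"
        using root_space_add[OF u v] unfolding root_space_def by (auto simp: zero_fun_def)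
    qed
    moreover have "cscale (K u v) (shp \<alpha>) \<in> t \<times> t"
      using sharp_t[OF \<alpha>] t_subspace
      by (auto simp: cscale_def mem_Times_iff intro!: subspace_add subspace_diff subspace_scale)
    ultimately show "cbr br u v - cscale (K u v) (shp \<alpha>) \<in> t \<times> t"
      using subspace_diff[OF t_subspace] by (auto simp: mem_Times_iff)
  next
    fix H assume H: "H \<in> t"
    have "K (cbr br u v) (of_real_form H) = - K v (cbr br u (of_real_form H))"
      by (rule C.killing_ad_skew)
    also have "cbr br u (of_real_form H) = - cscale (\<alpha> (of_real_form H)) u"
      using u H unfolding root_space_def by (simp add: C.br_anti[of u])
    finally show "K (cbr br u v - cscale (K u v) (shp \<alpha>)) (of_real_form H) = 0"
      by (simp add: C.killing_simps K_sharp[OF \<alpha> H] C.killing_sym[of v u])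
  qed
  then show ?thesis by simp
qed

section \<open>Multiplicity one and non-vanishing of brackets\<close>

text \<open>With the adjoint relation \<open>ad(E)\<^sup>* = - ad(conjugation E)\<close> and \<open>[conjugation E, E] = \<alpha>\<^sup>\<sharp>\<close>, positivity
  of the Hermitian form takes over the role of \<open>sl\<^sub>2\<close> representation theory below.\<close>

lemma sqnorm_cbr_raise:
  assumes \<alpha>: "\<alpha> \<in> roots br t" and E: "E \<in> root_space br t \<alpha>" "sqnorm E = 1"
    and \<beta>: "\<beta> \<in> cdual t" and Z: "Z \<in> root_space br t \<beta>" "cbr br (conjugation E) Z = 0"
  shows "sqnorm (cbr br E Z) = - Re (\<beta> (shp \<alpha>)) * sqnorm Z"
proof -
  have "cbr br E (conjugation E) = - shp \<alpha>"
    using cbr_opposite_root_spaces[OF \<alpha> E(1) conjugation_root_space[OF \<alpha> E(1)]] herm_self[of E] E(2)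
    by (simp add: K_conjugation_right)
  then have "cbr br (conjugation E) E = shp \<alpha>" by (simp add: C.br_anti[of "conjugation E"])
  \<comment> \<open>The derivation rule leaves only the bracket of \<open>shp \<alpha>\<close> with
    \<open>Z\<close>, since the conjugate of \<open>E\<close> kills \<open>Z\<close>. Adjointness
    then turns this into the square norm of \<open>[E, Z]\<close>.\<close>
  then have *: "cbr br (conjugation E) (cbr br E Z) = cscale (\<beta> (shp \<alpha>)) Z"
    using C.br_derivation[of "conjugation E" E Z] root_space_cbr[OF Z(1) \<beta> sharp_t[OF \<alpha>]] Z(2)
    by (simp add: C.br_simps)
  have "complex_of_real (sqnorm (cbr br E Z)) = - (cnj (\<beta> (shp \<alpha>)) * of_real (sqnorm Z))"
    by (simp add: herm_self[symmetric] herm_cbr[of E] * herm_simps)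
  from arg_cong[OF this, of Re] show ?thesis by simp
qed

text \<open>The raising formula for -\<alpha> with the conjugate of \<open>E\<close> in the role of
  \<open>E\<close>; the sign changes because
  \<open>shp (- \<alpha>) = - shp \<alpha>\<close>.\<close>

lemma sqnorm_cbr_lower:
  assumes \<alpha>: "\<alpha> \<in> roots br t" and E: "E \<in> root_space br t \<alpha>" "sqnorm E = 1"
    and \<beta>: "\<beta> \<in> cdual t" and Z: "Z \<in> root_space br t \<beta>" "cbr br E Z = 0"
  shows "sqnorm (cbr br (conjugation E) Z) = Re (\<beta> (shp \<alpha>)) * sqnorm Z"
proof -
  have "\<beta> (- shp \<alpha>) = - \<beta> (shp \<alpha>)"
    using cdual_cscale[OF \<beta> sharp_t[OF \<alpha>], of "-1"] C.scale_minus_left[of 1 "shp \<alpha>"] by simp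
  then show ?thesis
    using sqnorm_cbr_raise[OF uminus_roots[OF \<alpha>] conjugation_root_space[OF \<alpha> E(1)] _ \<beta> Z(1)] E(2) Z(2)
    by (simp add: sqnorm_conjugation sharp_uminus[OF \<alpha>])
qed

text \<open>The part \<open>Z\<close> of \<open>Y\<close> orthogonal to \<open>E\<close> is killed
  by the conjugate of \<open>E\<close>. The raising formula then makes a square norm equal to a
  negative multiple of that of \<open>Z\<close>, so \<open>Z = 0\<close>.\<close>

lemma root_space_one_dimensional:
  assumes \<alpha>: "\<alpha> \<in> roots br t" and E: "E \<in> root_space br t \<alpha>" "sqnorm E = 1"
    and Y: "Y \<in> root_space br t \<alpha>"
  shows "Y = cscale (herm Y E) E"
proof -
  define Z where "Z = Y - cscale (herm Y E) E"
  have Z: "Z \<in> root_space br t \<alpha>"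
    unfolding Z_def by (intro root_space_diff root_space_scale Y E)
  have "K Z (conjugation E) = 0"
    using herm_self[of E] E(2) by (simp add: Z_def K_conjugation_right herm_simps)
  then have "cbr br Z (conjugation E) = 0"
    using cbr_opposite_root_spaces[OF \<alpha> Z conjugation_root_space[OF \<alpha> E(1)]] by simp
  then have "cbr br (conjugation E) Z = 0" by (simp add: C.br_anti[of "conjugation E"])
  from sqnorm_cbr_raise[OF \<alpha> E roots_cdual[OF \<alpha>] Z this]
  have "Re (\<alpha> (shp \<alpha>)) * sqnorm Z \<le> 0" using sqnorm_nonneg[of "cbr br E Z"] by simp
  then have "sqnorm Z = 0"
    using root_sharp_pos[OF \<alpha>] sqnorm_nonneg[of Z] by (simp add: mult_le_0_iff)
  then show ?thesis unfolding sqnorm_eq_0 Z_def by simp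
qed

text \<open>If \<open>[E, F] = 0\<close>, lowering \<open>F\<close> gives
  \<beta>(\<open>shp \<alpha>\<close>) \<ge> 0. A unit vector \<open>Z\<close> for \<alpha> +
  \<beta> is lowered into the line of \<open>F\<close> but orthogonally to \<open>F\<close>, hence
  to zero, and raising it gives (\<alpha> + \<beta>)(\<open>shp \<alpha>\<close>) \<le> 0. Together
  these contradict \<alpha>(\<open>shp \<alpha>\<close>) > 0.\<close>

lemma cbr_root_vectors_nonzero:
  assumes \<alpha>: "\<alpha> \<in> roots br t" and \<beta>: "\<beta> \<in> roots br t" and sum: "\<alpha> + \<beta> \<in> roots br t"
    and E: "E \<in> root_space br t \<alpha>" "sqnorm E = 1" and F: "F \<in> root_space br t \<beta>" "sqnorm F = 1"
  shows "cbr br E F \<noteq> 0"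
proof
  assume EF: "cbr br E F = 0"
  obtain Z where Z: "Z \<in> root_space br t (\<alpha> + \<beta>)" "sqnorm Z = 1"
    using unit_root_vector_exists[OF sum] .
  have "cbr br (conjugation E) Z \<in> root_space br t (- \<alpha> + (\<alpha> + \<beta>))"
    by (intro root_space_add conjugation_root_space \<alpha> E Z)
  then have W: "cbr br (conjugation E) Z \<in> root_space br t \<beta>" by simp
  have "herm (cbr br (conjugation E) Z) F = 0"
    by (simp add: herm_cbr EF herm_simps)
  then have "cbr br (conjugation E) Z = 0"
    using root_space_one_dimensional[OF \<beta> F W] by simp
  then have "Re ((\<alpha> + \<beta>) (shp \<alpha>)) \<le> 0"
    using sqnorm_cbr_raise[OF \<alpha> E roots_cdual[OF sum] Z(1)] sqnorm_nonneg[of "cbr br E Z"] Z(2) by simp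
  moreover have "Re (\<beta> (shp \<alpha>)) \<ge> 0"
    using sqnorm_cbr_lower[OF \<alpha> E roots_cdual[OF \<beta>] F(1) EF] sqnorm_nonneg[of "cbr br (conjugation E) F"] F(2)
    by simp
  ultimately show False using root_sharp_pos[OF \<alpha>] by simp
qed

end


subsection \<open>Unit root vectors and Chevalley bases\<close>

context compact_cartan
begin

text \<open>The value zero off the roots lets the conjugation rule, and later the relations among
  coefficients, hold for all functionals without case distinctions.\<close>

definition unit_root_vectors :: "('a functional \<Rightarrow> 'a complexification) \<Rightarrow> bool" where
  "unit_root_vectors X \<longleftrightarrow>
     (\<forall>\<alpha>\<in>roots br t. X \<alpha> \<in> root_space br t \<alpha> \<and> sqnorm (X \<alpha>) = 1) \<and>
     (\<forall>\<alpha>. X (- \<alpha>) = - conjugation (X \<alpha>)) \<and> (\<forall>\<alpha>. \<alpha> \<notin> roots br t \<longrightarrow> X \<alpha> = 0)"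

text \<open>The Killing pairing with the opposite root vector reads off the coefficient of
  \<open>X (\<alpha> + \<beta>)\<close>. It is zero when \<alpha> + \<beta> is not a root, in
  particular at opposite roots.\<close>

definition bracket_coeff ::
    "('a functional \<Rightarrow> 'a complexification) \<Rightarrow> 'a functional \<Rightarrow> 'a functional \<Rightarrow> complex" where
  "bracket_coeff X \<alpha> \<beta> = K (cbr br (X \<alpha>) (X \<beta>)) (X (- (\<alpha> + \<beta>)))"

lemma zero_not_root: "0 \<notin> roots br t"
  by (simp add: roots_def)

context
  fixes X
  assumes X: "unit_root_vectors X"
begin

lemma
  shows unit_root_vectors_space: "\<alpha> \<in> roots br t \<Longrightarrow> X \<alpha> \<in> root_space br t \<alpha>"
    and unit_root_vectors_unit: "\<alpha> \<in> roots br t \<Longrightarrow> sqnorm (X \<alpha>) = 1"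
    and unit_root_vectors_uminus: "X (- \<alpha>) = - conjugation (X \<alpha>)"
    and unit_root_vectors_outside: "\<alpha> \<notin> roots br t \<Longrightarrow> X \<alpha> = 0"
  using X unfolding unit_root_vectors_def by blast+

lemma K_unit_root_vectors: "\<alpha> \<in> roots br t \<Longrightarrow> K (X \<alpha>) (X (- \<alpha>)) = 1"
  using herm_self[of "X \<alpha>"] unit_root_vectors_unit[of \<alpha>]
  by (simp add: unit_root_vectors_uminus C.killing_simps K_conjugation_right)

lemma cbr_uminus_unit_root_vectors:
  assumes \<alpha>: "\<alpha> \<in> roots br t"
  shows "cbr br (X \<alpha>) (X (- \<alpha>)) = shp \<alpha>"
  using cbr_opposite_root_spaces[OF \<alpha> unit_root_vectors_space[OF \<alpha>]
      unit_root_vectors_space[OF uminus_roots[OF \<alpha>]]] K_unit_root_vectors[OF \<alpha>]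
  by simp

lemma cbr_unit_root_vectors:
  assumes \<alpha>: "\<alpha> \<in> roots br t" and \<beta>: "\<beta> \<in> roots br t" and nz: "\<alpha> + \<beta> \<noteq> 0"
  shows "cbr br (X \<alpha>) (X \<beta>) = cscale (bracket_coeff X \<alpha> \<beta>) (X (\<alpha> + \<beta>))"
proof (cases "\<alpha> + \<beta> \<in> roots br t")
  case True
  have "cbr br (X \<alpha>) (X \<beta>) \<in> root_space br t (\<alpha> + \<beta>)"
    by (intro root_space_add unit_root_vectors_space \<alpha> \<beta>)
  from root_space_one_dimensional[OF True unit_root_vectors_space[OF True] unit_root_vectors_unit[OF True] this]
  show ?thesis
    unfolding bracket_coeff_def unit_root_vectors_uminus[of "\<alpha> + \<beta>"]
    by (simp add: C.killing_simps K_conjugation_right)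
next
  case False
  then show ?thesis
    using cbr_root_spaces_eq_0[OF \<alpha> \<beta> False nz unit_root_vectors_space[OF \<alpha>] unit_root_vectors_space[OF \<beta>]]
    by (simp add: unit_root_vectors_outside)
qed

text \<open>Invariance turns the left side into the pairing of
  \<open>[X \<alpha>, X \<beta>]\<close> with \<open>[X \<gamma>, X \<delta>]\<close>, multiples of
  root vectors for opposite roots. If \<alpha> + \<beta> is not a root, both sides vanish.\<close>

lemma K_double_bracket:
  assumes R: "\<alpha> \<in> roots br t" "\<beta> \<in> roots br t" "\<gamma> \<in> roots br t" "\<delta> \<in> roots br t"
    and sum: "\<alpha> + \<beta> + \<gamma> + \<delta> = 0" and nz: "\<alpha> + \<beta> \<noteq> 0"
  shows "K (cbr br (cbr br (X \<alpha>) (X \<beta>)) (X \<gamma>)) (X \<delta>) = bracket_coeff X \<alpha> \<beta> * bracket_coeff X \<gamma> \<delta>"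
proof -
  have eq: "\<gamma> + \<delta> = - (\<alpha> + \<beta>)" using sum by (simp add: eq_neg_iff_add_eq_0 algebra_simps)
  then have "\<gamma> + \<delta> \<noteq> 0" using nz by (metis neg_equal_0_iff_equal)
  then have "K (cbr br (cbr br (X \<alpha>) (X \<beta>)) (X \<gamma>)) (X \<delta>) =
      bracket_coeff X \<alpha> \<beta> * (bracket_coeff X \<gamma> \<delta> * K (X (\<alpha> + \<beta>)) (X (- (\<alpha> + \<beta>))))"
    unfolding C.killing_invariant cbr_unit_root_vectors[OF R(1,2) nz] eq[symmetric]
    by (simp add: cbr_unit_root_vectors[OF R(3,4)] C.killing_simps)
  moreover have "bracket_coeff X \<alpha> \<beta> = 0" if "\<alpha> + \<beta> \<notin> roots br t"
    unfolding bracket_coeff_def unit_root_vectors_uminus[of "\<alpha> + \<beta>"] unit_root_vectors_outside[OF that]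
    by (simp add: C.killing_simps)
  ultimately show ?thesis
    using K_unit_root_vectors[of "\<alpha> + \<beta>"] by (cases "\<alpha> + \<beta> \<in> roots br t") simp_all
qed

text \<open>The cyclic rule is invariance and symmetry of the Killing form, the sign rule is its
  compatibility with conjugation, and the four-root relation is the Jacobi identity paired with
  \<open>X \<delta>\<close>.\<close>

lemma structure_constants_bracket_coeff: "structure_constants (roots br t) (bracket_coeff X)"
  unfolding structure_constants_def
proof (intro conjI allI ballI impI)
  fix \<alpha> \<beta> \<gamma> \<delta> :: "'a functional"
  show "bracket_coeff X \<beta> \<alpha> = - bracket_coeff X \<alpha> \<beta>"
    by (simp only: bracket_coeff_def C.br_anti[of "X \<beta>" "X \<alpha>"] C.killing_simps add.commute[of \<beta> \<alpha>])
  show "bracket_coeff X \<alpha> \<beta> = bracket_coeff X \<beta> \<gamma>" if "\<alpha> + \<beta> + \<gamma> = 0"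
  proof -
    have "- (\<alpha> + \<beta>) = \<gamma>" "- (\<beta> + \<gamma>) = \<alpha>"
      using that by (simp_all add: neg_eq_iff_add_eq_0 algebra_simps)
    then show ?thesis
      unfolding bracket_coeff_def by (simp only: C.killing_invariant C.killing_sym[of _ "X \<alpha>"])
  qed
  have "X (- (- \<alpha> + - \<beta>)) = - conjugation (X (- (\<alpha> + \<beta>)))"
    unfolding unit_root_vectors_uminus[symmetric] by simp
  then show "bracket_coeff X (- \<alpha>) (- \<beta>) = - cnj (bracket_coeff X \<alpha> \<beta>)"
    unfolding bracket_coeff_def unit_root_vectors_uminus[of \<alpha>] unit_root_vectors_uminus[of \<beta>]
    by (simp only: C.br_simps C.killing_simps conjugation_cbr[symmetric] K_conjugation minus_minus)
  show "bracket_coeff X \<alpha> \<beta> = 0" if "\<alpha> + \<beta> \<notin> roots br t"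
    unfolding bracket_coeff_def unit_root_vectors_uminus[of "\<alpha> + \<beta>"] unit_root_vectors_outside[OF that]
    by (simp add: C.killing_simps)
  assume R: "\<alpha> \<in> roots br t" "\<beta> \<in> roots br t" "\<gamma> \<in> roots br t" "\<delta> \<in> roots br t"
    and sum: "\<alpha> + \<beta> + \<gamma> + \<delta> = 0"
    and nz: "\<alpha> + \<beta> \<noteq> 0" "\<beta> + \<gamma> \<noteq> 0" "\<gamma> + \<alpha> \<noteq> 0"
  have sums: "\<beta> + \<gamma> + \<alpha> + \<delta> = 0" "\<gamma> + \<alpha> + \<beta> + \<delta> = 0"
    using sum by (simp_all add: algebra_simps)
  have "cbr br (cbr br (X \<alpha>) (X \<beta>)) (X \<gamma>) + cbr br (cbr br (X \<beta>) (X \<gamma>)) (X \<alpha>)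
      + cbr br (cbr br (X \<gamma>) (X \<alpha>)) (X \<beta>) = 0"
  proof -
    have *: "cbr br (cbr br u v) w = - cbr br w (cbr br u v)" for u v w by (rule C.br_anti)
    show ?thesis
      unfolding *[of _ _ "X \<alpha>"] *[of _ _ "X \<beta>"] *[of _ _ "X \<gamma>"]
      using C.jacobi[of "X \<alpha>" "X \<beta>" "X \<gamma>"] by (simp add: algebra_simps neg_eq_iff_add_eq_0)
  qed
  from arg_cong[OF this, of "\<lambda>u. K u (X \<delta>)"]
  show "bracket_coeff X \<alpha> \<beta> * bracket_coeff X \<gamma> \<delta> + bracket_coeff X \<beta> \<gamma> * bracket_coeff X \<alpha> \<delta>
      + bracket_coeff X \<gamma> \<alpha> * bracket_coeff X \<beta> \<delta> = 0"
    by (simp only: C.killing_simps K_double_bracket[OF R sum nz(1)]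
        K_double_bracket[OF R(2,3,1,4) sums(1) nz(2)] K_double_bracket[OF R(3,1,2,4) sums(2) nz(3)])
qed

lemma sqnorm_cbr_unit_root_vectors:
  assumes R: "\<alpha> \<in> roots br t" "\<beta> \<in> roots br t" "\<alpha> + \<beta> \<in> roots br t"
  shows "sqnorm (cbr br (X \<alpha>) (X \<beta>)) = (cmod (bracket_coeff X \<alpha> \<beta>))\<^sup>2"
  using R(3) zero_not_root
  by (subst cbr_unit_root_vectors[OF R(1,2)]) (auto simp: sqnorm_cscale unit_root_vectors_unit)

end

text \<open>Root spaces are lines, so unit vectors in them differ by phases. These do not change the
  norm of a bracket, which is the modulus of its coefficient.\<close>

lemma cmod_bracket_coeff_unique:
  assumes X: "unit_root_vectors X" and Y: "unit_root_vectors Y"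
    and R: "\<alpha> \<in> roots br t" "\<beta> \<in> roots br t" "\<alpha> + \<beta> \<in> roots br t"
  shows "cmod (bracket_coeff X \<alpha> \<beta>) = cmod (bracket_coeff Y \<alpha> \<beta>)"
proof -
  have phase: "\<exists>z. cmod z = 1 \<and> Y \<gamma> = cscale z (X \<gamma>)" if "\<gamma> \<in> roots br t" for \<gamma>
  proof -
    have "Y \<gamma> = cscale (herm (Y \<gamma>) (X \<gamma>)) (X \<gamma>)"
      using root_space_one_dimensional unit_root_vectors_space[OF X] unit_root_vectors_unit[OF X]
        unit_root_vectors_space[OF Y] that by blast
    moreover from arg_cong[OF this, of sqnorm] have "cmod (herm (Y \<gamma>) (X \<gamma>)) = 1"
      using unit_root_vectors_unit[OF X that] unit_root_vectors_unit[OF Y that]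
      by (simp add: sqnorm_cscale power2_eq_1_iff) (metis norm_ge_zero not_one_le_zero neg_0_le_iff_le)
    ultimately show ?thesis by blast
  qed
  obtain y z where "cmod y = 1" "Y \<alpha> = cscale y (X \<alpha>)" "cmod z = 1" "Y \<beta> = cscale z (X \<beta>)"
    using phase R(1,2) by meson
  then have "sqnorm (cbr br (Y \<alpha>) (Y \<beta>)) = sqnorm (cbr br (X \<alpha>) (X \<beta>))"
    by (simp add: C.br_simps sqnorm_cscale norm_mult)
  then show ?thesis
    using sqnorm_cbr_unit_root_vectors[OF X R] sqnorm_cbr_unit_root_vectors[OF Y R] by simp
qed

text \<open>Reality of the coefficients is the only Chevalley condition that unit root vectors do
  not satisfy automatically.\<close>

lemma chevalley_basis_of_unit_root_vectors:
  assumes X: "unit_root_vectors X"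
    and c: "\<And>\<alpha> \<beta>. \<alpha> \<in> roots br t \<Longrightarrow> \<beta> \<in> roots br t \<Longrightarrow> bracket_coeff X \<alpha> \<beta> = of_real (c \<alpha> \<beta>)"
  shows "chevalley_basis br t X c"
  unfolding chevalley_basis_def
proof (intro conjI ballI impI)
  note sc = structure_constants_bracket_coeff[OF X]
  fix \<alpha> \<beta> assume R: "\<alpha> \<in> roots br t" "\<beta> \<in> roots br t"
  show "cbr br (X \<alpha>) (X \<beta>) = cscale (of_real (c \<alpha> \<beta>)) (X (\<alpha> + \<beta>))" if "\<alpha> + \<beta> \<in> roots br t"
  proof -
    have "\<alpha> + \<beta> \<noteq> 0" using that zero_not_root by metis
    then show ?thesis using cbr_unit_root_vectors[OF X R] c[OF R] by simp
  qed
  show "cbr br (X \<alpha>) (X \<beta>) = shp \<alpha>" if "\<alpha> + \<beta> = 0"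
    using cbr_uminus_unit_root_vectors[OF X R(1)] that by (metis add_eq_0_iff)
  show "cbr br (X \<alpha>) (X \<beta>) = 0" if "\<alpha> + \<beta> \<notin> roots br t \<and> \<alpha> + \<beta> \<noteq> 0"
    using cbr_unit_root_vectors[OF X R] unit_root_vectors_outside[OF X] that by auto
  show "c \<alpha> \<beta> = 0" if "\<alpha> + \<beta> \<notin> roots br t \<and> \<alpha> + \<beta> \<noteq> 0"
    using structure_constants_eq_0[OF sc, of \<alpha> \<beta>] c[OF R] that by simp
  have "complex_of_real (c (- \<alpha>) (- \<beta>)) = of_real (- c \<alpha> \<beta>)"
    using structure_constants_uminus[OF sc, of \<alpha> \<beta>] c[OF R] c[OF uminus_roots[OF R(1)] uminus_roots[OF R(2)]]
    by simp
  then show "c (- \<alpha>) (- \<beta>) = - c \<alpha> \<beta>" by (simp only: of_real_eq_iff)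
qed (use unit_root_vectors_space[OF X] in auto)

end

section \<open>Heights given by a regular element\<close>

locale compact_cartan_ordered = compact_cartan +
  fixes H0
  assumes H0: "H0 \<in> t" and regular: "\<And>\<alpha>. \<alpha> \<in> roots br t \<Longrightarrow> \<alpha> (of_real_form H0) \<noteq> 0"
begin

abbreviation height :: "'a functional \<Rightarrow> real" where
  "height \<alpha> \<equiv> Im (\<alpha> (of_real_form H0))"

lemma root_eq_height:
  assumes "\<alpha> \<in> roots br t"
  shows "\<alpha> (of_real_form H0) = \<i> * of_real (height \<alpha>)"
  using root_imaginary[OF assms H0] by (simp add: complex_eq_iff)

sublocale root_height "roots br t" height
proof
  show "height \<alpha> \<noteq> 0" if "\<alpha> \<in> roots br t" for \<alpha>
    using root_eq_height[OF that] regular[OF that] by auto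
qed (simp_all add: finite_roots uminus_roots)

lemma positive_roots_iff: "\<alpha> \<in> positive_roots br t H0 \<longleftrightarrow> \<alpha> \<in> roots br t \<and> height \<alpha> > 0"
  using root_eq_height[of \<alpha>] by (auto simp: positive_roots_def)

section \<open>Prescribed decompositions: existence and uniqueness of the constants\<close>

abbreviation decomposable where
  "decomposable \<equiv> positive_roots br t H0 - simple_roots br t H0"

lemma sum_decomposable:
  assumes "\<alpha> \<in> positive_roots br t H0" "\<beta> \<in> positive_roots br t H0" "\<alpha> + \<beta> \<in> roots br t"
  shows "\<alpha> + \<beta> \<in> decomposable"
proof -
  have "\<alpha> + \<beta> \<in> positive_roots br t H0" using assms by (simp add: positive_roots_iff)
  then show ?thesis using assms unfolding simple_roots_def by blast
qed

text \<open>A root that is a sum of two positive roots is decomposable, so its prescribed pair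
  serves as the pair required for comparing two systems.\<close>

lemma bracket_coeff_eqI:
  assumes c: "structure_constants (roots br t) c" "structure_constants (roots br t) c'"
    and dec: "\<And>\<alpha>. \<alpha> \<in> decomposable \<Longrightarrow>
      \<zeta> \<alpha> \<in> positive_roots br t H0 \<and> \<eta> \<alpha> \<in> positive_roots br t H0 \<and> \<alpha> = \<zeta> \<alpha> + \<eta> \<alpha>"
    and eq: "\<And>\<alpha>. \<alpha> \<in> decomposable \<Longrightarrow> c (\<zeta> \<alpha>) (\<eta> \<alpha>) = c' (\<zeta> \<alpha>) (\<eta> \<alpha>) \<and> c (\<zeta> \<alpha>) (\<eta> \<alpha>) \<noteq> 0"
    and R: "\<alpha> \<in> roots br t" "\<beta> \<in> roots br t"
  shows "c \<alpha> \<beta> = c' \<alpha> \<beta>"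
proof (rule structure_constants_eq[OF c _ R])
  fix \<alpha> \<beta> assume "\<alpha> \<in> roots br t" "\<beta> \<in> roots br t" "height \<alpha> > 0" "height \<beta> > 0" "\<alpha> + \<beta> \<in> roots br t"
  then have d: "\<alpha> + \<beta> \<in> decomposable" using sum_decomposable by (simp only: positive_roots_iff)
  show "\<exists>\<zeta>\<in>roots br t. \<exists>\<eta>\<in>roots br t. height \<zeta> > 0 \<and> height \<eta> > 0 \<and> \<alpha> + \<beta> = \<zeta> + \<eta> \<and>
      c \<zeta> \<eta> = c' \<zeta> \<eta> \<and> c \<zeta> \<eta> \<noteq> 0"
    using dec[OF d] eq[OF d] unfolding positive_roots_iff by blast
qed

text \<open>Recursion on the height: at a decomposable root the phase is fixed by normalizing the
  bracket of two vectors already chosen, whose heights are smaller. That bracket is non-zero, so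
  normalizing does give a unit vector.\<close>

lemma unit_root_vectors_exist:
  assumes dec: "\<And>\<alpha>. \<alpha> \<in> decomposable \<Longrightarrow>
      \<zeta> \<alpha> \<in> positive_roots br t H0 \<and> \<eta> \<alpha> \<in> positive_roots br t H0 \<and> \<alpha> = \<zeta> \<alpha> + \<eta> \<alpha>"
  obtains X where "unit_root_vectors X"
    and "\<And>\<alpha>. \<alpha> \<in> decomposable \<Longrightarrow> X \<alpha> = normalized (cbr br (X (\<zeta> \<alpha>)) (X (\<eta> \<alpha>)))"
proof -
  let ?less = "{(\<alpha>, \<beta>). \<alpha> \<in> roots br t \<and> \<beta> \<in> roots br t \<and> height \<alpha> < height \<beta>}"
  define F where "F = wfrec ?less (\<lambda>f \<alpha>. if \<alpha> \<in> decomposable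
    then normalized (cbr br (f (\<zeta> \<alpha>)) (f (\<eta> \<alpha>)))
    else (SOME u. u \<in> root_space br t \<alpha> \<and> sqnorm u = 1))"
  have less: "(\<zeta> \<alpha>, \<alpha>) \<in> ?less \<and> (\<eta> \<alpha>, \<alpha>) \<in> ?less" if "\<alpha> \<in> decomposable" for \<alpha>
  proof -
    have "height \<alpha> = height (\<zeta> \<alpha>) + height (\<eta> \<alpha>)" using dec[OF that] h_add by metis
    then show ?thesis using dec[OF that] that by (auto simp: positive_roots_iff)
  qed
  have F: "F \<alpha> = (if \<alpha> \<in> decomposable then normalized (cbr br (F (\<zeta> \<alpha>)) (F (\<eta> \<alpha>)))
    else (SOME u. u \<in> root_space br t \<alpha> \<and> sqnorm u = 1))" for \<alpha>
    unfolding def_wfrec[OF F_def[THEN eq_reflection] wf_height, of \<alpha>]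
    using less[of \<alpha>] by (auto simp: cut_def)
  have F_unit: "\<alpha> \<in> positive_roots br t H0 \<Longrightarrow> F \<alpha> \<in> root_space br t \<alpha> \<and> sqnorm (F \<alpha>) = 1" for \<alpha>
  proof (induction \<alpha> rule: wf_induct_rule[OF wf_height])
    case (1 \<alpha>)
    show ?case
    proof (cases "\<alpha> \<in> decomposable")
      case True
      have IH: "F (\<zeta> \<alpha>) \<in> root_space br t (\<zeta> \<alpha>) \<and> sqnorm (F (\<zeta> \<alpha>)) = 1"
        "F (\<eta> \<alpha>) \<in> root_space br t (\<eta> \<alpha>) \<and> sqnorm (F (\<eta> \<alpha>)) = 1"
        using 1(1) less[OF True] dec[OF True] by blast+
      have R: "\<zeta> \<alpha> \<in> roots br t" "\<eta> \<alpha> \<in> roots br t" "\<zeta> \<alpha> + \<eta> \<alpha> \<in> roots br t"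
        using dec[OF True] 1(2) by (auto simp: positive_roots_iff)
      have "cbr br (F (\<zeta> \<alpha>)) (F (\<eta> \<alpha>)) \<noteq> 0"
        using cbr_root_vectors_nonzero[OF R] IH by blast
      moreover have "cbr br (F (\<zeta> \<alpha>)) (F (\<eta> \<alpha>)) \<in> root_space br t \<alpha>"
        using root_space_add IH dec[OF True] by metis
      ultimately show ?thesis
        using True by (simp add: F[of \<alpha>] normalized_root_space sqnorm_normalized)
    next
      case False
      have "\<exists>u. u \<in> root_space br t \<alpha> \<and> sqnorm u = 1"
        using unit_root_vector_exists 1(2) positive_roots_iff by blast
      from someI_ex[OF this] show ?thesis unfolding F[of \<alpha>] if_not_P[OF False] .
    qed
  qed
  \<comment> \<open>Only the values of \<open>F\<close> at positive roots are kept; negative roots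
    are filled in by the conjugation rule.\<close>
  define X where "X \<alpha> = (if \<alpha> \<in> positive_roots br t H0 then F \<alpha>
    else if - \<alpha> \<in> positive_roots br t H0 then - conjugation (F (- \<alpha>)) else 0)" for \<alpha>
  have X_pos: "X \<alpha> = F \<alpha>" if "\<alpha> \<in> positive_roots br t H0" for \<alpha>
    using that by (simp add: X_def)
  have not_both: "- \<alpha> \<notin> positive_roots br t H0" if "\<alpha> \<in> positive_roots br t H0" for \<alpha>
    using that by (simp add: positive_roots_iff)
  have "unit_root_vectors X"
    unfolding unit_root_vectors_def
  proof (intro conjI allI ballI impI)
    fix \<alpha> :: "'a functional"
    show "X (- \<alpha>) = - conjugation (X \<alpha>)"
      using not_both[of \<alpha>] not_both[of "- \<alpha>"] by (simp add: X_def conjugation_uminus)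
    show "X \<alpha> = 0" if "\<alpha> \<notin> roots br t"
      using that uminus_roots[of "- \<alpha>"] by (auto simp: X_def positive_roots_iff)
    assume \<alpha>: "\<alpha> \<in> roots br t"
    then consider "\<alpha> \<in> positive_roots br t H0" | "- \<alpha> \<in> positive_roots br t H0"
      using h_nonzero[OF \<alpha>] uminus_roots[OF \<alpha>] unfolding positive_roots_iff by force
    then have "X \<alpha> \<in> root_space br t \<alpha> \<and> sqnorm (X \<alpha>) = 1"
    proof cases
      case 1
      then show ?thesis using F_unit X_pos by simp
    next
      case 2
      have "conjugation (F (- \<alpha>)) \<in> root_space br t (- (- \<alpha>))"
        using conjugation_root_space[OF uminus_roots[OF \<alpha>]] F_unit[OF 2] by blast
      moreover have "sqnorm (- u) = sqnorm u" for u
        by (simp add: sqnorm_def R.killing_simps)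
      ultimately show ?thesis
        using 2 not_both[OF 2] F_unit[OF 2] by (simp add: X_def root_space_uminus sqnorm_conjugation)
    qed
    then show "X \<alpha> \<in> root_space br t \<alpha>" "sqnorm (X \<alpha>) = 1" by blast+
  qed
  moreover have "X \<alpha> = normalized (cbr br (X (\<zeta> \<alpha>)) (X (\<eta> \<alpha>)))" if "\<alpha> \<in> decomposable" for \<alpha>
    using F[of \<alpha>] that dec[OF that] X_pos by simp
  ultimately show ?thesis using that by blast
qed

text \<open>With phases chosen recursively, the coefficients at the prescribed pairs are positive.
  Comparison with the conjugate system shows that all coefficients are real.\<close>

lemma chevalley_basis_exists:
  assumes dec: "\<And>\<alpha>. \<alpha> \<in> decomposable \<Longrightarrow>
      \<zeta> \<alpha> \<in> positive_roots br t H0 \<and> \<eta> \<alpha> \<in> positive_roots br t H0 \<and> \<alpha> = \<zeta> \<alpha> + \<eta> \<alpha>"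
  shows "\<exists>X c. chevalley_basis br t X c \<and>
     (\<forall>\<alpha>\<in>positive_roots br t H0. X (- \<alpha>) = - conjugation (X \<alpha>)) \<and>
     (\<forall>\<alpha>\<in>decomposable. c (\<zeta> \<alpha>) (\<eta> \<alpha>) > 0)"
proof -
  obtain X where X: "unit_root_vectors X"
    and X_dec: "\<And>\<alpha>. \<alpha> \<in> decomposable \<Longrightarrow> X \<alpha> = normalized (cbr br (X (\<zeta> \<alpha>)) (X (\<eta> \<alpha>)))"
    using unit_root_vectors_exist[OF dec] by blast
  note sc = structure_constants_bracket_coeff[OF X]
  have pos: "\<exists>r>0. bracket_coeff X (\<zeta> \<alpha>) (\<eta> \<alpha>) = of_real r" if d: "\<alpha> \<in> decomposable" for \<alpha>
  proof -
    let ?u = "cbr br (X (\<zeta> \<alpha>)) (X (\<eta> \<alpha>))"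
    have R: "\<zeta> \<alpha> \<in> roots br t" "\<eta> \<alpha> \<in> roots br t" "\<zeta> \<alpha> + \<eta> \<alpha> \<in> roots br t"
      using dec[OF d] d by (auto simp: positive_roots_iff)
    have "?u \<noteq> 0"
      using cbr_root_vectors_nonzero[OF R] unit_root_vectors_space[OF X] unit_root_vectors_unit[OF X] R
      by blast
    \<comment> \<open>Since \<open>X \<alpha>\<close> is \<open>?u\<close> normalized, this
      Hermitian product is the norm of \<open>?u\<close>.\<close>
    moreover have "bracket_coeff X (\<zeta> \<alpha>) (\<eta> \<alpha>) = herm ?u (X \<alpha>)"
      using dec[OF d] unit_root_vectors_uminus[OF X, of \<alpha>]
      by (simp add: bracket_coeff_def C.killing_simps K_conjugation_right)
    ultimately show ?thesis
      using real_sqrt_gt_zero[OF sqnorm_pos] X_dec[OF d] herm_normalized by metis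
  qed
  \<comment> \<open>A positive real value equals its conjugate, so the two systems agree at all
    prescribed pairs.\<close>
  have real: "bracket_coeff X \<alpha> \<beta> = cnj (bracket_coeff X \<alpha> \<beta>)"
    if "\<alpha> \<in> roots br t" "\<beta> \<in> roots br t" for \<alpha> \<beta>
    by (rule bracket_coeff_eqI[OF sc structure_constants_cnj[OF sc] dec _ that]) (use pos in force)+
  define c where "c \<alpha> \<beta> = Re (bracket_coeff X \<alpha> \<beta>)" for \<alpha> \<beta>
  have "chevalley_basis br t X c"
    by (rule chevalley_basis_of_unit_root_vectors[OF X])
      (use real in \<open>simp add: c_def complex_eq_iff\<close>)
  moreover have "c (\<zeta> \<alpha>) (\<eta> \<alpha>) > 0" if "\<alpha> \<in> decomposable" for \<alpha>
    using pos[OF that] by (auto simp: c_def)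
  ultimately show ?thesis using unit_root_vectors_uminus[OF X] by blast
qed

text \<open>The bracket rule for opposite roots forces
  \<open>K (X \<alpha>) (X (- \<alpha>)) = 1\<close> because \<open>shp \<alpha>\<close> is
  non-zero, and the conjugation rule identifies this number with the square norm. \<open>Y\<close>
  cuts off the arbitrary values of \<open>X\<close> outside the roots.\<close>

lemma unit_root_vectors_of_chevalley_basis:
  assumes X: "chevalley_basis br t X c"
    and conj: "\<forall>\<alpha>\<in>positive_roots br t H0. X (- \<alpha>) = - conjugation (X \<alpha>)"
  defines "Y \<equiv> \<lambda>\<alpha>. if \<alpha> \<in> roots br t then X \<alpha> else 0"
  shows "unit_root_vectors Y"
    and "\<And>\<alpha> \<beta>. \<alpha> \<in> roots br t \<Longrightarrow> \<beta> \<in> roots br t \<Longrightarrow> \<alpha> + \<beta> \<noteq> 0 \<Longrightarrow> bracket_coeff Y \<alpha> \<beta> = of_real (c \<alpha> \<beta>)"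
proof -
  have space: "X \<alpha> \<in> root_space br t \<alpha>" if "\<alpha> \<in> roots br t" for \<alpha>
    using X that unfolding chevalley_basis_def by blast
  have uminus: "X (- \<alpha>) = - conjugation (X \<alpha>)" if "\<alpha> \<in> roots br t" for \<alpha>
  proof (cases "height \<alpha> > 0")
    case True
    then show ?thesis using conj that positive_roots_iff by blast
  next
    case False
    then have "- \<alpha> \<in> positive_roots br t H0"
      using h_nonzero[OF that] uminus_roots[OF that] unfolding positive_roots_iff by force
    then have "X (- (- \<alpha>)) = - conjugation (X (- \<alpha>))" using conj by blast
    then show ?thesis by (simp add: conjugation_uminus)
  qed
  have unit: "sqnorm (X \<alpha>) = 1" if \<alpha>: "\<alpha> \<in> roots br t" for \<alpha>
  proof -
    note \<alpha>' = uminus_roots[OF \<alpha>]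
    have "cbr br (X \<alpha>) (X (- \<alpha>)) = shp \<alpha>"
      using X \<alpha> \<alpha>' unfolding chevalley_basis_def by simp
    then have "cscale (K (X \<alpha>) (X (- \<alpha>)) - 1) (shp \<alpha>) = 0"
      using cbr_opposite_root_spaces[OF \<alpha> space[OF \<alpha>] space[OF \<alpha>']]
      by (simp add: C.scale_left_diff_distrib)
    then have "K (X \<alpha>) (X (- \<alpha>)) = 1" using sharp_nonzero[OF \<alpha>] by simp
    then have "complex_of_real (sqnorm (X \<alpha>)) = of_real 1"
      by (simp add: uminus[OF \<alpha>] C.killing_simps K_conjugation_right herm_self)
    then show ?thesis by (simp only: of_real_eq_iff)
  qed
  show Y: "unit_root_vectors Y"
    unfolding unit_root_vectors_def
  proof (intro conjI allI ballI impI)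
    show "Y (- \<alpha>) = - conjugation (Y \<alpha>)" for \<alpha>
      using uminus uminus_roots[of \<alpha>] uminus_roots[of "- \<alpha>"] by (auto simp: Y_def)
  qed (simp_all add: Y_def space unit)
  show "bracket_coeff Y \<alpha> \<beta> = of_real (c \<alpha> \<beta>)"
    if R: "\<alpha> \<in> roots br t" "\<beta> \<in> roots br t" and nz: "\<alpha> + \<beta> \<noteq> 0" for \<alpha> \<beta>
  proof (cases "\<alpha> + \<beta> \<in> roots br t")
    case True
    have "cbr br (Y \<alpha>) (Y \<beta>) = cscale (of_real (c \<alpha> \<beta>)) (Y (\<alpha> + \<beta>))"
      using X R True unfolding chevalley_basis_def by (simp add: Y_def)
    then show ?thesis
      using K_unit_root_vectors[OF Y True] by (simp only: bracket_coeff_def C.killing_simps mult_1_right)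
  next
    case False
    have "c \<alpha> \<beta> = 0" using X R nz False unfolding chevalley_basis_def by blast
    then show ?thesis
      using structure_constants_eq_0[OF structure_constants_bracket_coeff[OF Y] False] by simp
  qed
qed

text \<open>At the prescribed pairs the moduli agree for any two families of unit root vectors; both
  values are positive, so they coincide and determine all others.\<close>

lemma chevalley_constants_unique:
  assumes dec: "\<And>\<alpha>. \<alpha> \<in> decomposable \<Longrightarrow>
      \<zeta> \<alpha> \<in> positive_roots br t H0 \<and> \<eta> \<alpha> \<in> positive_roots br t H0 \<and> \<alpha> = \<zeta> \<alpha> + \<eta> \<alpha>"
    and X: "chevalley_basis br t X c" "\<forall>\<alpha>\<in>positive_roots br t H0. X (- \<alpha>) = - conjugation (X \<alpha>)"
      "\<forall>\<alpha>\<in>decomposable. c (\<zeta> \<alpha>) (\<eta> \<alpha>) > 0"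
    and X': "chevalley_basis br t X' c'" "\<forall>\<alpha>\<in>positive_roots br t H0. X' (- \<alpha>) = - conjugation (X' \<alpha>)"
      "\<forall>\<alpha>\<in>decomposable. c' (\<zeta> \<alpha>) (\<eta> \<alpha>) > 0"
    and R: "\<alpha> \<in> roots br t" "\<beta> \<in> roots br t" "\<alpha> + \<beta> \<noteq> 0"
  shows "c \<alpha> \<beta> = c' \<alpha> \<beta>"
proof -
  define Y where "Y = (\<lambda>\<alpha>. if \<alpha> \<in> roots br t then X \<alpha> else 0)"
  define Y' where "Y' = (\<lambda>\<alpha>. if \<alpha> \<in> roots br t then X' \<alpha> else 0)"
  note Y = unit_root_vectors_of_chevalley_basis[OF X(1,2), folded Y_def]
  note Y' = unit_root_vectors_of_chevalley_basis[OF X'(1,2), folded Y'_def]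
  have "bracket_coeff Y \<alpha> \<beta> = bracket_coeff Y' \<alpha> \<beta>"
  proof (rule bracket_coeff_eqI[OF structure_constants_bracket_coeff[OF Y(1)]
        structure_constants_bracket_coeff[OF Y'(1)] dec _ R(1,2)])
    fix \<gamma> assume d: "\<gamma> \<in> decomposable"
    have S: "\<zeta> \<gamma> \<in> roots br t" "\<eta> \<gamma> \<in> roots br t" "\<zeta> \<gamma> + \<eta> \<gamma> \<in> roots br t"
      using dec[OF d] d by (auto simp: positive_roots_iff)
    then have "\<zeta> \<gamma> + \<eta> \<gamma> \<noteq> 0" using zero_not_root by auto
    then show "bracket_coeff Y (\<zeta> \<gamma>) (\<eta> \<gamma>) = bracket_coeff Y' (\<zeta> \<gamma>) (\<eta> \<gamma>) \<and>
        bracket_coeff Y (\<zeta> \<gamma>) (\<eta> \<gamma>) \<noteq> 0"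
      using cmod_bracket_coeff_unique[OF Y(1) Y'(1) S] X(3)[rule_format, OF d] X'(3)[rule_format, OF d]
      by (simp add: Y(2)[OF S(1,2)] Y'(2)[OF S(1,2)])
  qed
  then show ?thesis using Y(2)[OF R] Y'(2)[OF R] by simp
qed

end

theorem proposition3p5:
  fixes br :: "'a::real_vector \<Rightarrow> 'a \<Rightarrow> 'a"
    and t :: "'a set"
    and H0 :: 'a
    and \<zeta> \<eta> :: "'a functional \<Rightarrow> 'a functional"
  assumes "compact_lie_algebra br"
    and "cartan_subalgebra br t"
    and "H0 \<in> t"
    and "\<forall>\<alpha>\<in>roots br t. \<alpha> (of_real_form H0) \<noteq> 0"
    and "\<forall>\<alpha>\<in>positive_roots br t H0 - simple_roots br t H0.
           \<zeta> \<alpha> \<in> positive_roots br t H0 \<and> \<eta> \<alpha> \<in> positive_roots br t H0 \<and> \<alpha> = \<zeta> \<alpha> + \<eta> \<alpha>"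
  shows "let P = (\<lambda>X c. chevalley_basis br t X c \<and>
             (\<forall>\<alpha>\<in>positive_roots br t H0. X (- \<alpha>) = - conjugation (X \<alpha>)) \<and>
             (\<forall>\<alpha>\<in>positive_roots br t H0 - simple_roots br t H0. c (\<zeta> \<alpha>) (\<eta> \<alpha>) > 0))
         in (\<exists>X c. P X c) \<and>
            (\<forall>X c X' c'. P X c \<and> P X' c' \<longrightarrow>
               (\<forall>\<alpha>\<in>roots br t. \<forall>\<beta>\<in>roots br t. \<alpha> + \<beta> \<noteq> 0 \<longrightarrow> c \<alpha> \<beta> = c' \<alpha> \<beta>))"
proof -
  interpret compact_cartan_ordered br t H0
    by unfold_locales (use assms in auto)
  have dec: "\<zeta> \<alpha> \<in> positive_roots br t H0 \<and> \<eta> \<alpha> \<in> positive_roots br t H0 \<and> \<alpha> = \<zeta> \<alpha> + \<eta> \<alpha>"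
    if "\<alpha> \<in> decomposable" for \<alpha>
    using assms(5) that by blast
  show ?thesis
    unfolding Let_def
    using chevalley_basis_exists[OF dec] chevalley_constants_unique[OF dec] by blast
qed

end
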